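(* Let $R$ be either $\mathbf{Z}$ or $\mathbf{R}$, and let $\mathrm{Sp}_\infty(R)=\operatorname{colim}_h\mathrm{Sp}_{2h}(R)$ be the stable symplectic group. Then the restriction map of graded vector spaces $$H^*_b(\mathrm{Sp}_\infty(R);\mathbf{R})\to\lim_h H^*_b(\mathrm{Sp}_{2h}(R);\mathbf{R})$$ from the bounded cohomology of the stable symplectic group to the stable bounded cohomology of the finite-dimensional symplectic groups is not surjective.
   Context: $\mathrm{Sp}_{2h}(R)$ is the group of automorphisms of $R^{2h}$ preserving the standard symplectic form, regarded as a discrete group; the colimit is along the stabilization inclusions $\mathrm{Sp}_{2h}(R)\to\mathrm{Sp}_{2h+2}(R)$ extending an automorphism by the identity on the additional orthogonal summand $R^2$. $H^*_b(\Gamma;\mathbf{R})$ is the bounded cohomology of the discrete group $\Gamma$ (cohomology of the complex of bounded real cochains). The bounded cohomology of the groups $\mathrm{Sp}_{2h}(R)$ stabilizes (in each degree the stabilization inclusions induce isomorphisms for $h$ large), and the stable bounded cohomology is the resulting inverse limit, equivalently in each fixed degree $H^*_b(\mathrm{Sp}_{2h}(R);\mathbf{R})$ for $h$ large. The map is induced by the inclusions $\mathrm{Sp}_{2h}(R)\subset\mathrm{Sp}_\infty(R)$. *)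

theory Defs
  imports "Jordan_Normal_Form.Matrix" "HOL-Algebra.AbelCoset"
begin

section \<open>Bounded cohomology of discrete groups\<close>

definition real_field :: "real ring" where
  "real_field = \<lparr>carrier = UNIV, mult = (*), one = 1, zero = 0, add = (+)\<rparr>"

definition tuples :: "('a, 'm) monoid_scheme \<Rightarrow> nat \<Rightarrow> 'a list set" where
  "tuples G k = {xs. length xs = k \<and> set xs \<subseteq> carrier G}"

text \<open>The complex of bounded homogeneous cochains: \<open>n\<close>-cochains are the bounded functions
  \<open>G^(n+1) \<rightarrow> \<real>\<close> which are invariant under the diagonal left translation action. As functions on
  lists they are normalised to vanish outside \<open>G^(n+1)\<close>, so that equality of cochains is equality
  of functions.\<close>

definition bounded_cochains :: "('a, 'm) monoid_scheme \<Rightarrow> nat \<Rightarrow> ('a list \<Rightarrow> real) set" where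
  "bounded_cochains G n = {f.
     (\<forall>xs. xs \<notin> tuples G (Suc n) \<longrightarrow> f xs = 0) \<and>
     (\<forall>g\<in>carrier G. \<forall>xs\<in>tuples G (Suc n). f (map (\<lambda>x. g \<otimes>\<^bsub>G\<^esub> x) xs) = f xs) \<and>
     (\<exists>C. \<forall>xs\<in>tuples G (Suc n). \<bar>f xs\<bar> \<le> C)}"

definition coboundary :: "('a, 'm) monoid_scheme \<Rightarrow> nat \<Rightarrow> ('a list \<Rightarrow> real) \<Rightarrow> 'a list \<Rightarrow> real" where
  "coboundary G n f = (\<lambda>xs. if xs \<in> tuples G (n + 2)
     then \<Sum>i\<le>Suc n. (-1) ^ i * f (take i xs @ drop (Suc i) xs) else 0)"

definition bounded_cocycles :: "('a, 'm) monoid_scheme \<Rightarrow> nat \<Rightarrow> ('a list \<Rightarrow> real) set" where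
  "bounded_cocycles G n = {f \<in> bounded_cochains G n. coboundary G n f = (\<lambda>_. 0)}"

definition bounded_coboundaries :: "('a, 'm) monoid_scheme \<Rightarrow> nat \<Rightarrow> ('a list \<Rightarrow> real) set" where
  "bounded_coboundaries G n =
     (case n of 0 \<Rightarrow> {\<lambda>_. 0} | Suc m \<Rightarrow> coboundary G m ` bounded_cochains G m)"

definition cocycle_space :: "('a, 'm) monoid_scheme \<Rightarrow> nat \<Rightarrow> (real, 'a list \<Rightarrow> real) module" where
  "cocycle_space G n = \<lparr>carrier = bounded_cocycles G n, mult = undefined, one = undefined,
     zero = (\<lambda>_. 0), add = (\<lambda>f g xs. f xs + g xs), smult = (\<lambda>r f xs. r * f xs)\<rparr>"

definition quotient_module :: "('r, 'a) module \<Rightarrow> 'a set \<Rightarrow> ('r, 'a set) module" where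
  "quotient_module M N = \<lparr>carrier = a_rcosets\<^bsub>M\<^esub> N, mult = undefined, one = undefined,
     zero = N, add = set_add M, smult = (\<lambda>r X. \<Union>x\<in>X. N +>\<^bsub>M\<^esub> (r \<odot>\<^bsub>M\<^esub> x))\<rparr>"

definition bounded_cohomology ::
  "('a, 'm) monoid_scheme \<Rightarrow> nat \<Rightarrow> (real, ('a list \<Rightarrow> real) set) module" where
  "bounded_cohomology G n = quotient_module (cocycle_space G n) (bounded_coboundaries G n)"

definition bounded_class ::
  "('a, 'm) monoid_scheme \<Rightarrow> nat \<Rightarrow> ('a list \<Rightarrow> real) \<Rightarrow> ('a list \<Rightarrow> real) set" where
  "bounded_class G n f = bounded_coboundaries G n +>\<^bsub>cocycle_space G n\<^esub> f"

definition cochain_pullback ::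
  "('a, 'm) monoid_scheme \<Rightarrow> ('a \<Rightarrow> 'b) \<Rightarrow> nat \<Rightarrow> ('b list \<Rightarrow> real) \<Rightarrow> 'a list \<Rightarrow> real" where
  "cochain_pullback G \<phi> n f = (\<lambda>xs. if xs \<in> tuples G (Suc n) then f (map \<phi> xs) else 0)"

text \<open>For a homomorphism from \<open>G\<close> to \<open>H\<close>, this is the induced map from the bounded cohomology
  of \<open>H\<close> to that of \<open>G\<close>. All members of a class \<open>X\<close> have pullbacks in the same class, so the union
  is a single class, see \<open>bounded_cohomology_map_class\<close>.\<close>

definition bounded_cohomology_map ::
  "('a, 'm) monoid_scheme \<Rightarrow> ('a \<Rightarrow> 'b) \<Rightarrow> nat \<Rightarrow> ('b list \<Rightarrow> real) set \<Rightarrow> ('a list \<Rightarrow> real) set" where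
  "bounded_cohomology_map G \<phi> n X = (\<Union>f\<in>X. bounded_class G n (cochain_pullback G \<phi> n f))"


section \<open>Sequential limits and colimits\<close>

definition sequential_limit ::
  "(nat \<Rightarrow> ('r, 'a) module) \<Rightarrow> (nat \<Rightarrow> 'a \<Rightarrow> 'a) \<Rightarrow> ('r, nat \<Rightarrow> 'a) module" where
  "sequential_limit M p = \<lparr>
     carrier = {x. (\<forall>h. x h \<in> carrier (M h)) \<and> (\<forall>h. p h (x (Suc h)) = x h)},
     mult = undefined, one = undefined, zero = (\<lambda>h. \<zero>\<^bsub>M h\<^esub>),
     add = (\<lambda>x y h. x h \<oplus>\<^bsub>M h\<^esub> y h), smult = (\<lambda>r x h. r \<odot>\<^bsub>M h\<^esub> x h)\<rparr>"

primrec transition :: "(nat \<Rightarrow> 'a \<Rightarrow> 'a) \<Rightarrow> nat \<Rightarrow> nat \<Rightarrow> 'a \<Rightarrow> 'a" where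
  "transition s h 0 x = x"
| "transition s h (Suc i) x = s (h + i) (transition s h i x)"

definition colimit_rel ::
  "(nat \<Rightarrow> 'a monoid) \<Rightarrow> (nat \<Rightarrow> 'a \<Rightarrow> 'a) \<Rightarrow> ((nat \<times> 'a) \<times> (nat \<times> 'a)) set" where
  "colimit_rel G s = {((h, x), (k, y)). x \<in> carrier (G h) \<and> y \<in> carrier (G k) \<and>
     (\<exists>i j. h + i = k + j \<and> transition s h i x = transition s k j y)}"

definition colimit_inclusion ::
  "(nat \<Rightarrow> 'a monoid) \<Rightarrow> (nat \<Rightarrow> 'a \<Rightarrow> 'a) \<Rightarrow> nat \<Rightarrow> 'a \<Rightarrow> (nat \<times> 'a) set" where
  "colimit_inclusion G s h x = colimit_rel G s `` {(h, x)}"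

text \<open>Two elements of the colimit have representatives at a common stage, where they are
  multiplied.\<close>

definition sequential_colimit ::
  "(nat \<Rightarrow> 'a monoid) \<Rightarrow> (nat \<Rightarrow> 'a \<Rightarrow> 'a) \<Rightarrow> (nat \<times> 'a) set monoid" where
  "sequential_colimit G s = \<lparr>
     carrier = (SIGMA h:UNIV. carrier (G h)) // colimit_rel G s,
     mult = (\<lambda>X Y. \<Union>{colimit_inclusion G s h (x \<otimes>\<^bsub>G h\<^esub> y) | h x y. (h, x) \<in> X \<and> (h, y) \<in> Y}),
     one = colimit_inclusion G s 0 \<one>\<^bsub>G 0\<^esub>\<rparr>"


section \<open>Symplectic groups\<close>

text \<open>The symplectic basis is ordered as \<open>e\<^sub>1, f\<^sub>1, e\<^sub>2, f\<^sub>2, \<dots>\<close>, so that the summand added by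
  stabilization consists of the last two coordinates.\<close>

definition symplectic_form :: "nat \<Rightarrow> 'a :: comm_ring_1 vec \<Rightarrow> 'a vec \<Rightarrow> 'a" where
  "symplectic_form h v w =
     (\<Sum>i<h. v $ (2 * i) * w $ (2 * i + 1) - v $ (2 * i + 1) * w $ (2 * i))"

definition Sp :: "'a :: comm_ring_1 itself \<Rightarrow> nat \<Rightarrow> 'a mat monoid" where
  "Sp R h = \<lparr>
     carrier = {A \<in> carrier_mat (2 * h) (2 * h). invertible_mat A \<and>
       (\<forall>v\<in>carrier_vec (2 * h). \<forall>w\<in>carrier_vec (2 * h).
          symplectic_form h (A *\<^sub>v v) (A *\<^sub>v w) = symplectic_form h v w)},
     mult = (*), one = 1\<^sub>m (2 * h)\<rparr>"

definition Sp_stab :: "nat \<Rightarrow> 'a :: comm_ring_1 mat \<Rightarrow> 'a mat" where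
  "Sp_stab h A = four_block_mat A (0\<^sub>m (2 * h) 2) (0\<^sub>m 2 (2 * h)) (1\<^sub>m 2)"

definition Sp_infinity :: "'a :: comm_ring_1 itself \<Rightarrow> (nat \<times> 'a mat) set monoid" where
  "Sp_infinity R = sequential_colimit (Sp R) Sp_stab"

definition Sp_inclusion ::
  "'a :: comm_ring_1 itself \<Rightarrow> nat \<Rightarrow> 'a mat \<Rightarrow> (nat \<times> 'a mat) set" where
  "Sp_inclusion R = colimit_inclusion (Sp R) Sp_stab"

definition Sp_stable_bounded_cohomology ::
  "'a :: comm_ring_1 itself \<Rightarrow> nat \<Rightarrow> (real, nat \<Rightarrow> ('a mat list \<Rightarrow> real) set) module" where
  "Sp_stable_bounded_cohomology R n =
     sequential_limit (\<lambda>h. bounded_cohomology (Sp R h) n)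
       (\<lambda>h. bounded_cohomology_map (Sp R h) (Sp_stab h) n)"

definition Sp_restriction ::
  "'a :: comm_ring_1 itself \<Rightarrow> nat \<Rightarrow> ((nat \<times> 'a mat) set list \<Rightarrow> real) set
     \<Rightarrow> nat \<Rightarrow> ('a mat list \<Rightarrow> real) set" where
  "Sp_restriction R n X = (\<lambda>h. bounded_cohomology_map (Sp R h) (Sp_inclusion R h) n X)"


section \<open>Well-definedness\<close>

lemma cring_real_field: "cring real_field"
proof (rule cringI)
  show "abelian_group real_field"
  proof (rule abelian_groupI)
    fix x assume "x \<in> carrier real_field"
    show "\<exists>y\<in>carrier real_field. y \<oplus>\<^bsub>real_field\<^esub> x = \<zero>\<^bsub>real_field\<^esub>"
      by (rule bexI[of _ "- x"]) (simp_all add: real_field_def)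
  qed (simp_all add: real_field_def)
  show "comm_monoid real_field"
    by (rule comm_monoidI) (simp_all add: real_field_def)
qed (simp add: real_field_def distrib_right)

lemma delete_in_tuples:
  assumes "xs \<in> tuples G (n + 2)" "i \<le> Suc n"
  shows "take i xs @ drop (Suc i) xs \<in> tuples G (Suc n)"
  using assms set_take_subset[of i xs] set_drop_subset[of "Suc i" xs]
  by (auto simp: tuples_def)

lemma bounded_cochains_invariant:
  "f \<in> bounded_cochains G n \<Longrightarrow> g \<in> carrier G \<Longrightarrow> xs \<in> tuples G (Suc n) \<Longrightarrow>
    f (map ((\<otimes>\<^bsub>G\<^esub>) g) xs) = f xs"
  by (auto simp: bounded_cochains_def)

lemma coboundary_linear:
  "coboundary G n (\<lambda>xs. f xs + g xs) = (\<lambda>xs. coboundary G n f xs + coboundary G n g xs)"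
  "coboundary G n (\<lambda>xs. r * f xs) = (\<lambda>xs. r * coboundary G n f xs)"
  by (auto simp: coboundary_def fun_eq_iff sum.distrib sum_distrib_left algebra_simps)

lemma bounded_cochains_linear:
  assumes "f \<in> bounded_cochains G n" "g \<in> bounded_cochains G n"
  shows "(\<lambda>xs. f xs + g xs) \<in> bounded_cochains G n"
    and "(\<lambda>xs. r * f xs) \<in> bounded_cochains G n"
    and "(\<lambda>xs. 0) \<in> bounded_cochains G n"
proof -
  obtain C D where C: "\<forall>xs\<in>tuples G (Suc n). \<bar>f xs\<bar> \<le> C" and D: "\<forall>xs\<in>tuples G (Suc n). \<bar>g xs\<bar> \<le> D"
    using assms by (auto simp: bounded_cochains_def)
  have "\<forall>xs\<in>tuples G (Suc n). \<bar>f xs + g xs\<bar> \<le> C + D"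
    using C D abs_triangle_ineq by (metis (no_types, lifting) add_mono order_trans)
  then show "(\<lambda>xs. f xs + g xs) \<in> bounded_cochains G n"
    using assms unfolding bounded_cochains_def by auto
  have "\<forall>xs\<in>tuples G (Suc n). \<bar>r * f xs\<bar> \<le> \<bar>r\<bar> * C"
    using C by (simp add: abs_mult mult_left_mono)
  then show "(\<lambda>xs. r * f xs) \<in> bounded_cochains G n"
    using assms unfolding bounded_cochains_def by auto
qed (auto simp: bounded_cochains_def)

lemma zero_bounded_cochain: "(\<lambda>xs. 0) \<in> bounded_cochains G n"
  by (auto simp: bounded_cochains_def)

lemma coboundary_zero: "coboundary G n (\<lambda>xs. 0) = (\<lambda>xs. 0)"
  by (simp add: coboundary_def fun_eq_iff)

lemma coboundary_bounded_cochain: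
  assumes "group G" "f \<in> bounded_cochains G n"
  shows "coboundary G n f \<in> bounded_cochains G (Suc n)"
proof -
  interpret group G by fact
  obtain C where C: "\<forall>xs\<in>tuples G (Suc n). \<bar>f xs\<bar> \<le> C"
    using assms by (auto simp: bounded_cochains_def)
  have "\<bar>coboundary G n f xs\<bar> \<le> (\<Sum>i\<le>Suc n. C)" if "xs \<in> tuples G (n + 2)" for xs
  proof -
    have "\<bar>coboundary G n f xs\<bar> \<le> (\<Sum>i\<le>Suc n. \<bar>(-1) ^ i * f (take i xs @ drop (Suc i) xs)\<bar>)"
      using that unfolding coboundary_def by (simp only: if_True sum_abs)
    also have "\<dots> \<le> (\<Sum>i\<le>Suc n. C)"
      by (rule sum_mono) (use C delete_in_tuples[OF that] in \<open>simp add: abs_mult\<close>)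
    finally show ?thesis .
  qed
  moreover have "coboundary G n f (map ((\<otimes>\<^bsub>G\<^esub>) g) xs) = coboundary G n f xs"
    if "g \<in> carrier G" "xs \<in> tuples G (n + 2)" for g xs
  proof -
    have "map ((\<otimes>\<^bsub>G\<^esub>) g) xs \<in> tuples G (n + 2)" using that by (auto simp: tuples_def)
    moreover have "f (take i (map ((\<otimes>\<^bsub>G\<^esub>) g) xs) @ drop (Suc i) (map ((\<otimes>\<^bsub>G\<^esub>) g) xs))
        = f (take i xs @ drop (Suc i) xs)" if "i \<le> Suc n" for i
    proof -
      have "take i (map ((\<otimes>\<^bsub>G\<^esub>) g) xs) @ drop (Suc i) (map ((\<otimes>\<^bsub>G\<^esub>) g) xs)
          = map ((\<otimes>\<^bsub>G\<^esub>) g) (take i xs @ drop (Suc i) xs)"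
        by (simp add: take_map drop_map)
      then show ?thesis
        using bounded_cochains_invariant[OF assms(2) \<open>g \<in> carrier G\<close>
            delete_in_tuples[OF \<open>xs \<in> tuples G (n + 2)\<close> that]] by (simp only:)
    qed
    ultimately show ?thesis using that unfolding coboundary_def by (simp del: sum.atMost_Suc)
  qed
  ultimately show ?thesis
    unfolding bounded_cochains_def by (auto simp: coboundary_def)
qed

lemma coboundary_coboundary:
  "coboundary G (Suc n) (coboundary G n f) = (\<lambda>xs. 0)"
proof
  fix xs
  show "coboundary G (Suc n) (coboundary G n f) xs = 0"
  proof (cases "xs \<in> tuples G (n + 3)")
    case False
    then show ?thesis by (simp add: coboundary_def numeral_eq_Suc)
  next
    case True
    define d where "d = (\<lambda>i (ys :: 'a list). take i ys @ drop (Suc i) ys)"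
    define t where "t = (\<lambda>(i, j). (-1 :: real) ^ (i + j) * f (d j (d i xs)))"
    have len: "length xs = n + 3" using True by (simp add: tuples_def)
    have dd: "d j (d i xs) = d (i - 1) (d j xs)" if "j < i" "i \<le> Suc (Suc n)" for i j
      by (rule nth_equalityI) (use that len in \<open>auto simp: d_def nth_append\<close>)
    have "coboundary G (Suc n) (coboundary G n f) xs
        = (\<Sum>i\<le>Suc (Suc n). (-1) ^ i * coboundary G n f (d i xs))"
      using True by (simp add: coboundary_def d_def numeral_eq_Suc del: sum.atMost_Suc)
    also have "\<dots> = (\<Sum>i\<le>Suc (Suc n). \<Sum>j\<le>Suc n. t (i, j))"
    proof (rule sum.cong[OF refl])
      fix i assume "i \<in> {..Suc (Suc n)}"
      then have "d i xs \<in> tuples G (n + 2)"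
        using delete_in_tuples[of xs G "Suc n" i] True by (simp add: d_def numeral_eq_Suc)
      then show "(-1) ^ i * coboundary G n f (d i xs) = (\<Sum>j\<le>Suc n. t (i, j))"
        unfolding coboundary_def t_def
        by (simp add: d_def sum_distrib_left power_add mult.assoc del: sum.atMost_Suc)
    qed
    also have "\<dots> = sum t ({..Suc (Suc n)} \<times> {..Suc n})"
      by (simp add: sum.cartesian_product del: sum.atMost_Suc)
    also have "{..Suc (Suc n)} \<times> {..Suc n} =
        {(i, j). j < i \<and> i \<le> Suc (Suc n)} \<union> {(i, j). i \<le> j \<and> j \<le> Suc n}" by auto
    also have "sum t \<dots> = sum t {(i, j). j < i \<and> i \<le> Suc (Suc n)} + sum t {(i, j). i \<le> j \<and> j \<le> Suc n}"
    proof (rule sum.union_disjoint)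
      show "finite {(i, j). j < i \<and> i \<le> Suc (Suc n)}"
        by (rule finite_subset[of _ "{..Suc (Suc n)} \<times> {..Suc (Suc n)}"]) auto
      show "finite {(i, j). i \<le> j \<and> j \<le> Suc n}"
        by (rule finite_subset[of _ "{..Suc (Suc n)} \<times> {..Suc (Suc n)}"]) auto
    qed auto
    also have "sum t {(i, j). j < i \<and> i \<le> Suc (Suc n)} = - sum t {(i, j). i \<le> j \<and> j \<le> Suc n}"
      unfolding sum_negf[symmetric]
    proof (rule sum.reindex_bij_witness[of _ "\<lambda>(i, j). (Suc j, i)" "\<lambda>(i, j). (j, i - 1)"])
      fix p assume "p \<in> {(i, j). j < i \<and> i \<le> Suc (Suc n)}"
      then obtain i j where p: "p = (Suc i, j)" "j < Suc i" "Suc i \<le> Suc (Suc n)"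
        by (cases p; cases "fst p") auto
      then show "- t (case p of (i, j) \<Rightarrow> (j, i - 1)) = t p"
        using dd[of j "Suc i"] by (simp add: t_def add.commute)
    qed auto
    finally show ?thesis by simp
  qed
qed

lemma bounded_coboundaries_subset:
  assumes "group G"
  shows "bounded_coboundaries G n \<subseteq> bounded_cocycles G n"
  using assms
  by (auto simp: bounded_coboundaries_def bounded_cocycles_def coboundary_zero zero_bounded_cochain
      coboundary_bounded_cochain coboundary_coboundary split: nat.splits)

lemma bounded_cocycles_linear:
  assumes "f \<in> bounded_cocycles G n" "g \<in> bounded_cocycles G n"
  shows "(\<lambda>xs. f xs + g xs) \<in> bounded_cocycles G n"
    and "(\<lambda>xs. r * f xs) \<in> bounded_cocycles G n"
  using assms by (auto simp: bounded_cocycles_def bounded_cochains_linear coboundary_linear)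

lemma bounded_coboundaries_linear:
  assumes "f \<in> bounded_coboundaries G n" "g \<in> bounded_coboundaries G n"
  shows "(\<lambda>xs. f xs + g xs) \<in> bounded_coboundaries G n"
    and "(\<lambda>xs. r * f xs) \<in> bounded_coboundaries G n"
proof -
  show "(\<lambda>xs. f xs + g xs) \<in> bounded_coboundaries G n"
  proof (cases n)
    case (Suc m)
    then obtain a b where ab: "a \<in> bounded_cochains G m" "b \<in> bounded_cochains G m"
      "f = coboundary G m a" "g = coboundary G m b"
      using assms by (auto simp: bounded_coboundaries_def)
    then show ?thesis
      using bounded_cochains_linear(1)[OF ab(1,2)] coboundary_linear(1)[of G m a b] Suc
      by (auto simp: bounded_coboundaries_def intro!: image_eqI[where x = "\<lambda>xs. a xs + b xs"])
  qed (use assms in \<open>simp add: bounded_coboundaries_def\<close>)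
  show "(\<lambda>xs. r * f xs) \<in> bounded_coboundaries G n"
  proof (cases n)
    case (Suc m)
    then obtain a where a: "a \<in> bounded_cochains G m" "f = coboundary G m a"
      using assms by (auto simp: bounded_coboundaries_def)
    then show ?thesis
      using bounded_cochains_linear(2)[OF a(1) a(1)] coboundary_linear(2)[of G m r a] Suc
      by (auto simp: bounded_coboundaries_def intro!: image_eqI[where x = "\<lambda>xs. r * a xs"])
  qed (use assms in \<open>simp add: bounded_coboundaries_def\<close>)
qed

lemma module_cocycle_space: "module real_field (cocycle_space G n)"
proof (rule moduleI[OF cring_real_field])
  have neg: "(\<lambda>xs. - f xs) \<in> bounded_cocycles G n" if "f \<in> bounded_cocycles G n" for f
    using bounded_cocycles_linear(2)[OF that that, of "-1"] by simp
  show "abelian_group (cocycle_space G n)"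
  proof (rule abelian_groupI)
    show "\<zero>\<^bsub>cocycle_space G n\<^esub> \<in> carrier (cocycle_space G n)"
      by (simp add: cocycle_space_def bounded_cocycles_def zero_bounded_cochain coboundary_zero)
    fix f assume "f \<in> carrier (cocycle_space G n)"
    then show "\<exists>g\<in>carrier (cocycle_space G n). g \<oplus>\<^bsub>cocycle_space G n\<^esub> f = \<zero>\<^bsub>cocycle_space G n\<^esub>"
      by (intro bexI[of _ "\<lambda>xs. - f xs"]) (simp_all add: cocycle_space_def neg)
  qed (auto simp: cocycle_space_def bounded_cocycles_linear algebra_simps)
qed (auto simp: cocycle_space_def real_field_def bounded_cocycles_linear algebra_simps)

lemma bounded_class_altdef:
  "bounded_class G n f = {\<lambda>xs. b xs + f xs | b. b \<in> bounded_coboundaries G n}"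
  by (auto simp: bounded_class_def a_r_coset_def r_coset_def cocycle_space_def)

lemma zero_bounded_coboundary: "(\<lambda>xs. 0) \<in> bounded_coboundaries G n"
  by (auto simp: bounded_coboundaries_def zero_bounded_cochain coboundary_zero
      intro!: image_eqI[where x = "\<lambda>xs. 0"] split: nat.splits)

lemma bounded_class_eq_iff:
  "bounded_class G n f = bounded_class G n g \<longleftrightarrow> (\<lambda>xs. f xs - g xs) \<in> bounded_coboundaries G n"
proof
  assume "bounded_class G n f = bounded_class G n g"
  moreover have "f \<in> bounded_class G n f"
    using zero_bounded_coboundary[of G n] by (force simp: bounded_class_altdef)
  ultimately show "(\<lambda>xs. f xs - g xs) \<in> bounded_coboundaries G n"
    by (auto simp: bounded_class_altdef)
next
  have *: "bounded_class G n f \<subseteq> bounded_class G n g"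
    if "(\<lambda>xs. f xs - g xs) \<in> bounded_coboundaries G n" for f g
  proof
    fix u assume "u \<in> bounded_class G n f"
    then obtain b where b: "b \<in> bounded_coboundaries G n" "u = (\<lambda>xs. b xs + f xs)"
      by (auto simp: bounded_class_altdef)
    then have "(\<lambda>xs. b xs + (f xs - g xs)) \<in> bounded_coboundaries G n"
      using bounded_coboundaries_linear(1)[OF b(1) that] by simp
    then show "u \<in> bounded_class G n g"
      unfolding bounded_class_altdef b(2)
      by (intro CollectI exI[of _ "\<lambda>xs. b xs + (f xs - g xs)"]) auto
  qed
  assume "(\<lambda>xs. f xs - g xs) \<in> bounded_coboundaries G n"
  then show "bounded_class G n f = bounded_class G n g"
    using *[of f g] *[of g f] bounded_coboundaries_linear(2)[of "\<lambda>xs. f xs - g xs" G n _ "-1"]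
    by auto
qed

lemma carrier_bounded_cohomology:
  "carrier (bounded_cohomology G n) = bounded_class G n ` bounded_cocycles G n"
  by (auto simp: bounded_cohomology_def quotient_module_def A_RCOSETS_def RCOSETS_def
      bounded_class_def a_r_coset_def cocycle_space_def)

lemma add_bounded_cohomology:
  "bounded_class G n f \<oplus>\<^bsub>bounded_cohomology G n\<^esub> bounded_class G n g
     = bounded_class G n (\<lambda>xs. f xs + g xs)"
proof -
  have "bounded_class G n f \<oplus>\<^bsub>bounded_cohomology G n\<^esub> bounded_class G n g
      = {\<lambda>xs. u xs + v xs | u v. u \<in> bounded_class G n f \<and> v \<in> bounded_class G n g}"
    by (auto simp: bounded_cohomology_def quotient_module_def set_add_def set_mult_def cocycle_space_def)
  also have "\<dots> = bounded_class G n (\<lambda>xs. f xs + g xs)"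
  proof (rule subset_antisym; rule subsetI)
    fix w assume "w \<in> {\<lambda>xs. u xs + v xs | u v. u \<in> bounded_class G n f \<and> v \<in> bounded_class G n g}"
    then obtain a b where ab: "a \<in> bounded_coboundaries G n" "b \<in> bounded_coboundaries G n"
      "w = (\<lambda>xs. (a xs + f xs) + (b xs + g xs))"
      by (auto simp: bounded_class_altdef)
    show "w \<in> bounded_class G n (\<lambda>xs. f xs + g xs)"
      unfolding bounded_class_altdef ab(3) using bounded_coboundaries_linear(1)[OF ab(1,2)]
      by (intro CollectI exI[of _ "\<lambda>xs. a xs + b xs"]) auto
  next
    fix w assume "w \<in> bounded_class G n (\<lambda>xs. f xs + g xs)"
    then obtain a where a: "a \<in> bounded_coboundaries G n" "w = (\<lambda>xs. a xs + (f xs + g xs))"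
      by (auto simp: bounded_class_altdef)
    have "(\<lambda>xs. a xs + f xs) \<in> bounded_class G n f" "g \<in> bounded_class G n g"
      using a(1) zero_bounded_coboundary[of G n] by (force simp: bounded_class_altdef)+
    then show "w \<in> {\<lambda>xs. u xs + v xs | u v. u \<in> bounded_class G n f \<and> v \<in> bounded_class G n g}"
      unfolding a(2) by (intro CollectI exI[of _ "\<lambda>xs. a xs + f xs"] exI[of _ g]) auto
  qed
  finally show ?thesis .
qed

lemma smult_bounded_cohomology:
  "r \<odot>\<^bsub>bounded_cohomology G n\<^esub> bounded_class G n f = bounded_class G n (\<lambda>xs. r * f xs)"
proof -
  have "bounded_class G n (\<lambda>xs. r * u xs) = bounded_class G n (\<lambda>xs. r * f xs)"
    if u: "u \<in> bounded_class G n f" for u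
  proof -
    obtain b where "b \<in> bounded_coboundaries G n" "u = (\<lambda>xs. b xs + f xs)"
      using u by (auto simp: bounded_class_altdef)
    then show ?thesis
      using bounded_coboundaries_linear(2)[of b G n b r]
      by (simp add: bounded_class_eq_iff algebra_simps)
  qed
  moreover have "f \<in> bounded_class G n f"
    using zero_bounded_coboundary[of G n] by (force simp: bounded_class_altdef)
  ultimately have "(\<Union>u\<in>bounded_class G n f. bounded_class G n (\<lambda>xs. r * u xs))
      = bounded_class G n (\<lambda>xs. r * f xs)" by blast
  then show ?thesis
    by (simp add: bounded_cohomology_def quotient_module_def bounded_class_def[symmetric])
      (simp add: cocycle_space_def)
qed

lemma zero_bounded_cohomology:
  "\<zero>\<^bsub>bounded_cohomology G n\<^esub> = bounded_class G n (\<lambda>xs. 0)"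
  by (auto simp: bounded_cohomology_def quotient_module_def bounded_class_altdef)

lemmas cohomology_simps = carrier_bounded_cohomology add_bounded_cohomology
  smult_bounded_cohomology zero_bounded_cohomology

theorem module_bounded_cohomology: "module real_field (bounded_cohomology G n)"
proof (rule moduleI[OF cring_real_field])
  have zero: "(\<lambda>xs. 0) \<in> bounded_cocycles G n"
    by (simp add: bounded_cocycles_def zero_bounded_cochain coboundary_zero)
  show "abelian_group (bounded_cohomology G n)"
  proof (rule abelian_groupI)
    fix X assume "X \<in> carrier (bounded_cohomology G n)"
    then obtain f where f: "f \<in> bounded_cocycles G n" "X = bounded_class G n f"
      by (auto simp: cohomology_simps)
    then show "\<exists>Y\<in>carrier (bounded_cohomology G n).
        Y \<oplus>\<^bsub>bounded_cohomology G n\<^esub> X = \<zero>\<^bsub>bounded_cohomology G n\<^esub>"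
      using bounded_cocycles_linear(2)[of f G n f "-1"]
      by (intro bexI[of _ "bounded_class G n (\<lambda>xs. -1 * f xs)"]) (auto simp: cohomology_simps)
  qed (auto simp: cohomology_simps zero bounded_cocycles_linear algebra_simps)
qed (auto simp: cohomology_simps real_field_def bounded_cocycles_linear algebra_simps)

lemma tuples_map: "\<phi> \<in> hom G H \<Longrightarrow> xs \<in> tuples G k \<Longrightarrow> map \<phi> xs \<in> tuples H k"
  by (auto simp: tuples_def hom_def)

lemma cochain_pullback_bounded_cochain:
  assumes "group G" "\<phi> \<in> hom G H" "f \<in> bounded_cochains H n"
  shows "cochain_pullback G \<phi> n f \<in> bounded_cochains G n"
proof -
  interpret group G by fact
  have "f (map \<phi> (map ((\<otimes>\<^bsub>G\<^esub>) g) xs)) = f (map \<phi> xs)"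
    if "g \<in> carrier G" "xs \<in> tuples G (Suc n)" for g xs
  proof -
    have "map \<phi> (map ((\<otimes>\<^bsub>G\<^esub>) g) xs) = map (\<lambda>x. \<phi> g \<otimes>\<^bsub>H\<^esub> x) (map \<phi> xs)"
      using that assms(2) by (auto simp: tuples_def hom_def subset_iff)
    moreover have "\<phi> g \<in> carrier H" using assms(2) that by (auto simp: hom_def)
    ultimately show ?thesis
      using bounded_cochains_invariant[OF assms(3) _ tuples_map[OF assms(2) that(2)]]
      by (simp only:)
  qed
  moreover have "map ((\<otimes>\<^bsub>G\<^esub>) g) xs \<in> tuples G (Suc n)"
    if "g \<in> carrier G" "xs \<in> tuples G (Suc n)" for g xs
    using that by (auto simp: tuples_def)
  moreover have "\<exists>C. \<forall>xs\<in>tuples G (Suc n). \<bar>f (map \<phi> xs)\<bar> \<le> C"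
    using assms(3) tuples_map[OF assms(2)] unfolding bounded_cochains_def by blast
  ultimately show ?thesis
    unfolding bounded_cochains_def cochain_pullback_def by auto
qed

lemma coboundary_pullback:
  assumes "\<phi> \<in> hom G H"
  shows "coboundary G n (cochain_pullback G \<phi> n f) = cochain_pullback G \<phi> (Suc n) (coboundary H n f)"
proof
  fix xs
  show "coboundary G n (cochain_pullback G \<phi> n f) xs
      = cochain_pullback G \<phi> (Suc n) (coboundary H n f) xs"
  proof (cases "xs \<in> tuples G (n + 2)")
    case True
    then show ?thesis
      using tuples_map[OF assms True] delete_in_tuples[OF True]
      by (auto simp: coboundary_def cochain_pullback_def take_map drop_map simp del: sum.atMost_Suc
          intro!: sum.cong)
  qed (simp add: coboundary_def cochain_pullback_def)
qed

lemma cochain_pullback_cocycle: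
  assumes "group G" "\<phi> \<in> hom G H" "f \<in> bounded_cocycles H n"
  shows "cochain_pullback G \<phi> n f \<in> bounded_cocycles G n"
  using assms cochain_pullback_bounded_cochain[OF assms(1,2)] coboundary_pullback[OF assms(2), of n f]
  by (auto simp: bounded_cocycles_def cochain_pullback_def)

lemma cochain_pullback_coboundary:
  assumes "group G" "\<phi> \<in> hom G H" "f \<in> bounded_coboundaries H n"
  shows "cochain_pullback G \<phi> n f \<in> bounded_coboundaries G n"
proof (cases n)
  case 0
  then show ?thesis using assms(3) by (auto simp: bounded_coboundaries_def cochain_pullback_def)
next
  case (Suc m)
  then obtain b where b: "b \<in> bounded_cochains H m" "f = coboundary H m b"
    using assms(3) by (auto simp: bounded_coboundaries_def)
  then show ?thesis
    using cochain_pullback_bounded_cochain[OF assms(1,2) b(1)] coboundary_pullback[OF assms(2), of m b, symmetric] Suc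
    by (simp add: bounded_coboundaries_def)
qed

lemma bounded_cohomology_map_class:
  assumes "group G" "\<phi> \<in> hom G H"
  shows "bounded_cohomology_map G \<phi> n (bounded_class H n f)
    = bounded_class G n (cochain_pullback G \<phi> n f)"
proof -
  have "bounded_class G n (cochain_pullback G \<phi> n u) = bounded_class G n (cochain_pullback G \<phi> n f)"
    if u: "u \<in> bounded_class H n f" for u
  proof -
    obtain b where b: "b \<in> bounded_coboundaries H n" "u = (\<lambda>xs. b xs + f xs)"
      using u by (auto simp: bounded_class_altdef)
    have "(\<lambda>xs. cochain_pullback G \<phi> n u xs - cochain_pullback G \<phi> n f xs) = cochain_pullback G \<phi> n b"
      by (auto simp: cochain_pullback_def b(2))
    then show ?thesis
      using cochain_pullback_coboundary[OF assms b(1)] by (simp add: bounded_class_eq_iff)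
  qed
  moreover have "f \<in> bounded_class H n f"
    using zero_bounded_coboundary[of H n] by (force simp: bounded_class_altdef)
  ultimately show ?thesis unfolding bounded_cohomology_map_def by blast
qed

theorem bounded_cohomology_map_linear:
  assumes "group G" "\<phi> \<in> hom G H"
    and "X \<in> carrier (bounded_cohomology H n)" "Y \<in> carrier (bounded_cohomology H n)"
  shows "bounded_cohomology_map G \<phi> n X \<in> carrier (bounded_cohomology G n)"
    and "bounded_cohomology_map G \<phi> n (X \<oplus>\<^bsub>bounded_cohomology H n\<^esub> Y) =
      bounded_cohomology_map G \<phi> n X \<oplus>\<^bsub>bounded_cohomology G n\<^esub> bounded_cohomology_map G \<phi> n Y"
    and "bounded_cohomology_map G \<phi> n (r \<odot>\<^bsub>bounded_cohomology H n\<^esub> X) =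
      r \<odot>\<^bsub>bounded_cohomology G n\<^esub> bounded_cohomology_map G \<phi> n X"
proof -
  obtain f g where fg: "f \<in> bounded_cocycles H n" "X = bounded_class H n f" "Y = bounded_class H n g"
    using assms by (auto simp: carrier_bounded_cohomology)
  show "bounded_cohomology_map G \<phi> n X \<in> carrier (bounded_cohomology G n)"
    using fg cochain_pullback_cocycle[OF assms(1,2)]
    by (simp add: bounded_cohomology_map_class[OF assms(1,2)] carrier_bounded_cohomology)
  have *: "cochain_pullback G \<phi> n (\<lambda>xs. f xs + g xs) =
      (\<lambda>xs. cochain_pullback G \<phi> n f xs + cochain_pullback G \<phi> n g xs)"
    "cochain_pullback G \<phi> n (\<lambda>xs. r * f xs) = (\<lambda>xs. r * cochain_pullback G \<phi> n f xs)"
    by (auto simp: cochain_pullback_def)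
  show "bounded_cohomology_map G \<phi> n (X \<oplus>\<^bsub>bounded_cohomology H n\<^esub> Y) =
      bounded_cohomology_map G \<phi> n X \<oplus>\<^bsub>bounded_cohomology G n\<^esub> bounded_cohomology_map G \<phi> n Y"
    by (simp add: fg add_bounded_cohomology bounded_cohomology_map_class[OF assms(1,2)] *)
  show "bounded_cohomology_map G \<phi> n (r \<odot>\<^bsub>bounded_cohomology H n\<^esub> X) =
      r \<odot>\<^bsub>bounded_cohomology G n\<^esub> bounded_cohomology_map G \<phi> n X"
    by (simp add: fg smult_bounded_cohomology bounded_cohomology_map_class[OF assms(1,2)] *)
qed

theorem bounded_cohomology_map_comp:
  assumes "group G" "group H" "\<phi> \<in> hom G H" "\<psi> \<in> hom H K" "\<chi> \<in> hom G K"
    and "\<And>x. x \<in> carrier G \<Longrightarrow> \<psi> (\<phi> x) = \<chi> x"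
    and "X \<in> carrier (bounded_cohomology K n)"
  shows "bounded_cohomology_map G \<phi> n (bounded_cohomology_map H \<psi> n X) = bounded_cohomology_map G \<chi> n X"
proof -
  obtain f where f: "X = bounded_class K n f"
    using assms by (auto simp: carrier_bounded_cohomology)
  have "cochain_pullback G \<phi> n (cochain_pullback H \<psi> n f) xs = cochain_pullback G \<chi> n f xs" for xs
  proof (cases "xs \<in> tuples G (Suc n)")
    case True
    then have "map \<psi> (map \<phi> xs) = map \<chi> xs" using assms(6) by (auto simp: tuples_def)
    then show ?thesis
      using True tuples_map[OF assms(3) True] by (simp add: cochain_pullback_def del: map_map)
  qed (simp add: cochain_pullback_def)
  then have "cochain_pullback G \<phi> n (cochain_pullback H \<psi> n f) = cochain_pullback G \<chi> n f" by blast
  then show ?thesis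
    by (simp add: f bounded_cohomology_map_class[OF assms(1,3)] bounded_cohomology_map_class[OF assms(2,4)]
        bounded_cohomology_map_class[OF assms(1,5)])
qed


locale group_sequence =
  fixes G :: "nat \<Rightarrow> 'a monoid" and s :: "nat \<Rightarrow> 'a \<Rightarrow> 'a"
  assumes groups: "group (G h)" and hom_step: "s h \<in> hom (G h) (G (Suc h))"
begin

lemma transition_hom: "transition s h i \<in> hom (G h) (G (h + i))"
proof (induction i)
  case (Suc i)
  then show ?case using hom_step[of "h + i"] by (auto simp: hom_def Pi_iff)
qed (auto simp: hom_def)

lemma transition_closed: "x \<in> carrier (G h) \<Longrightarrow> transition s h i x \<in> carrier (G (h + i))"
  using transition_hom by (auto simp: hom_def)

lemma transition_add: "transition s h (i + j) x = transition s (h + i) j (transition s h i x)"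
  by (induction j) (auto simp: add.assoc)

lemma equiv_colimit_rel: "equiv (SIGMA h:UNIV. carrier (G h)) (colimit_rel G s)"
proof (rule equivI)
  show "colimit_rel G s \<subseteq> (SIGMA h:UNIV. carrier (G h)) \<times> (SIGMA h:UNIV. carrier (G h))"
    by (auto simp: colimit_rel_def)
  show "refl_on (SIGMA h:UNIV. carrier (G h)) (colimit_rel G s)"
    by (auto simp: refl_on_def colimit_rel_def)
  show "sym (colimit_rel G s)"
    unfolding sym_def colimit_rel_def by (auto, metis)
  show "trans (colimit_rel G s)"
  proof (rule transI)
    fix p q r assume pq: "(p, q) \<in> colimit_rel G s" and qr: "(q, r) \<in> colimit_rel G s"
    obtain h x k y l z where [simp]: "p = (h, x)" "q = (k, y)" "r = (l, z)"
      by (cases p; cases q; cases r)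
    obtain i j where 1: "h + i = k + j" "transition s h i x = transition s k j y"
      using pq by (auto simp: colimit_rel_def)
    obtain a b where 2: "k + a = l + b" "transition s k a y = transition s l b z"
      using qr by (auto simp: colimit_rel_def)
    have "transition s h (i + a) x = transition s k (j + a) y"
      using 1 by (simp add: transition_add)
    also have "\<dots> = transition s (k + a) j (transition s k a y)"
      by (simp add: add.commute[of j] transition_add)
    also have "\<dots> = transition s l (b + j) z"
      using 2 by (simp add: transition_add)
    finally have "transition s h (i + a) x = transition s l (b + j) z" .
    moreover have "h + (i + a) = l + (b + j)" using 1 2 by simp
    moreover have "x \<in> carrier (G h)" "z \<in> carrier (G l)"
      using pq qr by (auto simp: colimit_rel_def)
    ultimately show "(p, r) \<in> colimit_rel G s"
      unfolding colimit_rel_def by auto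
  qed
qed

lemma colimit_inclusion_eq_iff:
  assumes "x \<in> carrier (G h)" "y \<in> carrier (G k)"
  shows "colimit_inclusion G s h x = colimit_inclusion G s k y \<longleftrightarrow>
    (\<exists>i j. h + i = k + j \<and> transition s h i x = transition s k j y)"
  using eq_equiv_class_iff[OF equiv_colimit_rel, of "(h, x)" "(k, y)"] assms
  by (simp add: colimit_inclusion_def colimit_rel_def)

lemma mem_colimit_inclusion:
  assumes "x \<in> carrier (G h)"
  shows "(k, y) \<in> colimit_inclusion G s h x \<longleftrightarrow>
    y \<in> carrier (G k) \<and> colimit_inclusion G s k y = colimit_inclusion G s h x"
  using equiv_class_eq_iff[OF equiv_colimit_rel, of "(h, x)" "(k, y)"] assms
  by (auto simp: colimit_inclusion_def)

lemma colimit_inclusion_transition: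
  assumes "x \<in> carrier (G h)"
  shows "colimit_inclusion G s (h + i) (transition s h i x) = colimit_inclusion G s h x"
proof -
  have "h + i + 0 = h + i \<and> transition s (h + i) 0 (transition s h i x) = transition s h i x" by simp
  then show ?thesis
    using colimit_inclusion_eq_iff[OF transition_closed[OF assms] assms] by blast
qed

lemma carrier_colimit:
  "carrier (sequential_colimit G s) = (\<Union>h. colimit_inclusion G s h ` carrier (G h))"
  by (auto simp: sequential_colimit_def quotient_def colimit_inclusion_def)

lemma colimit_inclusion_closed:
  "x \<in> carrier (G h) \<Longrightarrow> colimit_inclusion G s h x \<in> carrier (sequential_colimit G s)"
  by (auto simp: carrier_colimit)

lemma common_stage:
  assumes "X \<in> carrier (sequential_colimit G s)"
  obtains h where "\<And>k. k \<ge> h \<Longrightarrow> \<exists>x\<in>carrier (G k). X = colimit_inclusion G s k x"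
proof -
  obtain h x where hx: "x \<in> carrier (G h)" "X = colimit_inclusion G s h x"
    using assms by (auto simp: carrier_colimit)
  have "\<exists>x\<in>carrier (G k). X = colimit_inclusion G s k x" if "k \<ge> h" for k
    using colimit_inclusion_transition[OF hx(1), of "k - h"] transition_closed[OF hx(1), of "k - h"]
      that hx(2) by auto
  then show ?thesis using that by blast
qed

lemma mult_colimit:
  assumes "x \<in> carrier (G h)" "y \<in> carrier (G h)"
  shows "colimit_inclusion G s h x \<otimes>\<^bsub>sequential_colimit G s\<^esub> colimit_inclusion G s h y =
    colimit_inclusion G s h (x \<otimes>\<^bsub>G h\<^esub> y)"
proof -
  interpret G: group "G m" for m by (rule groups)
  let ?S = "{colimit_inclusion G s k (u \<otimes>\<^bsub>G k\<^esub> v) | k u v.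
    (k, u) \<in> colimit_inclusion G s h x \<and> (k, v) \<in> colimit_inclusion G s h y}"
  have "colimit_inclusion G s k (u \<otimes>\<^bsub>G k\<^esub> v) = colimit_inclusion G s h (x \<otimes>\<^bsub>G h\<^esub> y)"
    if "(k, u) \<in> colimit_inclusion G s h x" "(k, v) \<in> colimit_inclusion G s h y" for k u v
  proof -
    have uv: "u \<in> carrier (G k)" "v \<in> carrier (G k)"
      "colimit_inclusion G s k u = colimit_inclusion G s h x"
      "colimit_inclusion G s k v = colimit_inclusion G s h y"
      using that assms by (auto simp: mem_colimit_inclusion)
    obtain i j where 1: "k + i = h + j" "transition s k i u = transition s h j x"
      using uv assms by (auto simp: colimit_inclusion_eq_iff)
    obtain a b where 2: "k + a = h + b" "transition s k a v = transition s h b y"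
      using uv assms by (auto simp: colimit_inclusion_eq_iff)
    have e: "j + a = b + i" using 1 2 by simp
    have "transition s k (i + a) u = transition s h (j + a) x"
      using 1 by (simp add: transition_add)
    moreover have "transition s k (a + i) v = transition s h (b + i) y"
      using 2 by (simp add: transition_add)
    ultimately have "transition s k (i + a) (u \<otimes>\<^bsub>G k\<^esub> v) = transition s h (j + a) (x \<otimes>\<^bsub>G h\<^esub> y)"
      using hom_mult[OF transition_hom uv(1,2), of "i + a"]
        hom_mult[OF transition_hom assms, of "j + a"] e 1 by (simp add: add.commute add.left_commute)
    moreover have "k + (i + a) = h + (j + a)" using 1 by simp
    ultimately show ?thesis
      using colimit_inclusion_eq_iff uv(1,2) assms by blast
  qed
  moreover have "(h, x) \<in> colimit_inclusion G s h x" "(h, y) \<in> colimit_inclusion G s h y"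
    using assms by (auto simp: mem_colimit_inclusion)
  ultimately have "?S = {colimit_inclusion G s h (x \<otimes>\<^bsub>G h\<^esub> y)}" by blast
  then show ?thesis by (simp add: sequential_colimit_def)
qed

lemma one_colimit: "\<one>\<^bsub>sequential_colimit G s\<^esub> = colimit_inclusion G s h \<one>\<^bsub>G h\<^esub>"
proof -
  have "transition s 0 h \<one>\<^bsub>G 0\<^esub> = \<one>\<^bsub>G h\<^esub>"
    using hom_one[OF transition_hom[of 0 h] groups groups] by simp
  then show ?thesis
    using colimit_inclusion_transition[of "\<one>\<^bsub>G 0\<^esub>" 0 h] group.is_monoid[OF groups]
    by (simp add: sequential_colimit_def monoid.one_closed)
qed

lemma colimit_inclusion_hom: "colimit_inclusion G s h \<in> hom (G h) (sequential_colimit G s)"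
  by (auto simp: hom_def colimit_inclusion_closed mult_colimit)

lemma colimit_inclusion_step:
  "x \<in> carrier (G h) \<Longrightarrow> colimit_inclusion G s (Suc h) (s h x) = colimit_inclusion G s h x"
  using colimit_inclusion_transition[of x h 1] by simp

theorem group_colimit: "group (sequential_colimit G s)"
proof (rule groupI)
  interpret G: group "G m" for m by (rule groups)
  let ?L = "sequential_colimit G s"
  show "\<one>\<^bsub>?L\<^esub> \<in> carrier ?L" by (simp add: one_colimit[of 0] colimit_inclusion_closed)
  fix X assume X: "X \<in> carrier ?L"
  obtain h where h: "\<And>k. k \<ge> h \<Longrightarrow> \<exists>x\<in>carrier (G k). X = colimit_inclusion G s k x"
    using common_stage[OF X] by blast
  obtain x where x: "x \<in> carrier (G h)" "X = colimit_inclusion G s h x" using h by blast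
  show "\<one>\<^bsub>?L\<^esub> \<otimes>\<^bsub>?L\<^esub> X = X" by (simp add: one_colimit[of h] x mult_colimit)
  show "\<exists>Y\<in>carrier ?L. Y \<otimes>\<^bsub>?L\<^esub> X = \<one>\<^bsub>?L\<^esub>"
    by (rule bexI[of _ "colimit_inclusion G s h (inv\<^bsub>G h\<^esub> x)"])
      (simp_all add: one_colimit[of h] x mult_colimit colimit_inclusion_closed)
  fix Y assume Y: "Y \<in> carrier ?L"
  obtain k where k: "\<And>l. l \<ge> k \<Longrightarrow> \<exists>y\<in>carrier (G l). Y = colimit_inclusion G s l y"
    using common_stage[OF Y] by blast
  obtain x y where "x \<in> carrier (G (max h k))" "X = colimit_inclusion G s (max h k) x"
    "y \<in> carrier (G (max h k))" "Y = colimit_inclusion G s (max h k) y"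
    using h[of "max h k"] k[of "max h k"] by auto
  then show "X \<otimes>\<^bsub>?L\<^esub> Y \<in> carrier ?L" by (simp add: mult_colimit colimit_inclusion_closed)
  fix Z assume Z: "Z \<in> carrier ?L"
  obtain l where l: "\<And>m. m \<ge> l \<Longrightarrow> \<exists>z\<in>carrier (G m). Z = colimit_inclusion G s m z"
    using common_stage[OF Z] by blast
  define m where "m = max h (max k l)"
  have "m \<ge> h" "m \<ge> k" "m \<ge> l" by (auto simp: m_def)
  then obtain x y z where "x \<in> carrier (G m)" "X = colimit_inclusion G s m x"
    "y \<in> carrier (G m)" "Y = colimit_inclusion G s m y"
    "z \<in> carrier (G m)" "Z = colimit_inclusion G s m z"
    using h[of m] k[of m] l[of m] by blast
  then show "X \<otimes>\<^bsub>?L\<^esub> Y \<otimes>\<^bsub>?L\<^esub> Z = X \<otimes>\<^bsub>?L\<^esub> (Y \<otimes>\<^bsub>?L\<^esub> Z)"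
    by (simp add: mult_colimit G.m_assoc)
qed

end


theorem group_Sp: "group (Sp (R :: 'a :: comm_ring_1 itself) h)"
proof (rule groupI)
  let ?n = "2 * h"
  fix A assume "A \<in> carrier (Sp R h)"
  then have A: "A \<in> carrier_mat ?n ?n" "invertible_mat A"
    "\<And>v w. v \<in> carrier_vec ?n \<Longrightarrow> w \<in> carrier_vec ?n \<Longrightarrow>
      symplectic_form h (A *\<^sub>v v) (A *\<^sub>v w) = symplectic_form h v w"
    by (auto simp: Sp_def)
  show "\<one>\<^bsub>Sp R h\<^esub> \<otimes>\<^bsub>Sp R h\<^esub> A = A" using A by (simp add: Sp_def)
  obtain B where B: "A * B = 1\<^sub>m ?n" "B * A = 1\<^sub>m (dim_row B)"
    using A by (auto simp: invertible_mat_def inverts_mat_def)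
  have Bc: "B \<in> carrier_mat ?n ?n"
    using A(1) B by (metis carrier_matD(2) carrier_matI index_mult_mat(3) index_one_mat(3))
  have "symplectic_form h (B *\<^sub>v v) (B *\<^sub>v w) = symplectic_form h v w"
    if "v \<in> carrier_vec ?n" "w \<in> carrier_vec ?n" for v w
  proof -
    have "A *\<^sub>v (B *\<^sub>v u) = u" if "u \<in> carrier_vec ?n" for u
      using assoc_mult_mat_vec[OF A(1) Bc that] B that by simp
    then show ?thesis using A(3)[of "B *\<^sub>v v" "B *\<^sub>v w"] that Bc by simp
  qed
  moreover have "invertible_mat B"
    using A(1) B Bc by (auto simp: invertible_mat_def inverts_mat_def intro!: exI[of _ A])
  ultimately show "\<exists>B\<in>carrier (Sp R h). B \<otimes>\<^bsub>Sp R h\<^esub> A = \<one>\<^bsub>Sp R h\<^esub>"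
    using B Bc by (intro bexI[of _ B]) (auto simp: Sp_def)
  fix B assume "B \<in> carrier (Sp R h)"
  then have B: "B \<in> carrier_mat ?n ?n" "invertible_mat B"
    "\<And>v w. v \<in> carrier_vec ?n \<Longrightarrow> w \<in> carrier_vec ?n \<Longrightarrow>
      symplectic_form h (B *\<^sub>v v) (B *\<^sub>v w) = symplectic_form h v w"
    by (auto simp: Sp_def)
  obtain A' where A': "A * A' = 1\<^sub>m ?n" "A' * A = 1\<^sub>m (dim_row A')"
    using A by (auto simp: invertible_mat_def inverts_mat_def)
  obtain B' where B': "B * B' = 1\<^sub>m ?n" "B' * B = 1\<^sub>m (dim_row B')"
    using B by (auto simp: invertible_mat_def inverts_mat_def)
  have c: "A' \<in> carrier_mat ?n ?n" "B' \<in> carrier_mat ?n ?n"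
    using A(1) A' B(1) B' by (metis carrier_matD(2) carrier_matI index_mult_mat(3) index_one_mat(3))+
  have "(A * B) * (B' * A') = A * ((B * B') * A')"
    using A(1) B(1) c by (simp add: assoc_mult_mat[of _ ?n ?n _ ?n _ ?n] mult_carrier_mat[of _ ?n ?n _ ?n])
  moreover have "(B' * A') * (A * B) = B' * ((A' * A) * B)"
    using A(1) B(1) c by (simp add: assoc_mult_mat[of _ ?n ?n _ ?n _ ?n] mult_carrier_mat[of _ ?n ?n _ ?n])
  ultimately have "invertible_mat (A * B)"
    using A(1) B(1) A' B' c
    by (auto simp: invertible_mat_def inverts_mat_def intro!: exI[of _ "B' * A'"])
  moreover have "symplectic_form h (A * B *\<^sub>v v) (A * B *\<^sub>v w) = symplectic_form h v w"
    if "v \<in> carrier_vec ?n" "w \<in> carrier_vec ?n" for v w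
    using A(3)[of "B *\<^sub>v v" "B *\<^sub>v w"] B(3)[OF that] that B(1)
    by (simp add: assoc_mult_mat_vec[OF A(1) B(1)])
  ultimately show "A \<otimes>\<^bsub>Sp R h\<^esub> B \<in> carrier (Sp R h)"
    using A(1) B(1) by (auto simp: Sp_def)
  fix C assume "C \<in> carrier (Sp R h)"
  then show "A \<otimes>\<^bsub>Sp R h\<^esub> B \<otimes>\<^bsub>Sp R h\<^esub> C = A \<otimes>\<^bsub>Sp R h\<^esub> (B \<otimes>\<^bsub>Sp R h\<^esub> C)"
    using A(1) B(1) by (auto simp: Sp_def assoc_mult_mat[of _ ?n ?n _ ?n _ ?n])
next
  show "\<one>\<^bsub>Sp R h\<^esub> \<in> carrier (Sp R h)"
    by (auto simp: Sp_def invertible_mat_def inverts_mat_def intro!: exI[of _ "1\<^sub>m (2 * h)"])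
qed

lemma Sp_stab_mult:
  assumes "A \<in> carrier_mat (2 * h) (2 * h)" "B \<in> carrier_mat (2 * h) (2 * h)"
  shows "Sp_stab h A * Sp_stab h B = Sp_stab h (A * B)"
  unfolding Sp_stab_def
  by (subst mult_four_block_mat[of _ "2 * h" "2 * h" _ 2 _ 2 _ _ "2 * h" _ 2])
    (use assms in \<open>auto simp: mult_carrier_mat[of _ "2 * h" "2 * h"]\<close>)

theorem Sp_stab_hom: "Sp_stab h \<in> hom (Sp R h) (Sp (R :: 'a :: comm_ring_1 itself) (Suc h))"
proof (rule homI)
  let ?n = "2 * h"
  fix A assume A: "A \<in> carrier (Sp R h)"
  then have Ac: "A \<in> carrier_mat ?n ?n" and inv: "invertible_mat A" and
    sympl: "\<And>v w. v \<in> carrier_vec ?n \<Longrightarrow> w \<in> carrier_vec ?n \<Longrightarrow>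
      symplectic_form h (A *\<^sub>v v) (A *\<^sub>v w) = symplectic_form h v w"
    by (auto simp: Sp_def)
  obtain B where B: "A * B = 1\<^sub>m ?n" "B * A = 1\<^sub>m (dim_row B)"
    using Ac inv by (auto simp: invertible_mat_def inverts_mat_def)
  have Bc: "B \<in> carrier_mat ?n ?n"
    using Ac B by (metis carrier_matD(2) carrier_matI index_mult_mat(3) index_one_mat(3))
  have one: "Sp_stab h (1\<^sub>m ?n) = (1\<^sub>m (?n + 2) :: 'a mat)"
    unfolding Sp_stab_def by (rule four_block_one_mat)
  have "invertible_mat (Sp_stab h A)"
    using Sp_stab_mult[OF Ac Bc] Sp_stab_mult[OF Bc Ac] B Ac Bc one
    by (auto simp: invertible_mat_def inverts_mat_def intro!: exI[of _ "Sp_stab h B"])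
      (auto simp: Sp_stab_def)
  moreover have "symplectic_form (Suc h) (Sp_stab h A *\<^sub>v v) (Sp_stab h A *\<^sub>v w) = symplectic_form (Suc h) v w"
    if "v \<in> carrier_vec (2 * Suc h)" "w \<in> carrier_vec (2 * Suc h)" for v w
  proof -
    have app: "Sp_stab h A *\<^sub>v (a @\<^sub>v d) = (A *\<^sub>v a) @\<^sub>v d"
      if "a \<in> carrier_vec ?n" "d \<in> carrier_vec 2" for a d
    proof -
      have "Sp_stab h A *\<^sub>v (a @\<^sub>v d) = (A *\<^sub>v a + 0\<^sub>m ?n 2 *\<^sub>v d) @\<^sub>v (0\<^sub>m 2 ?n *\<^sub>v a + 1\<^sub>m 2 *\<^sub>v d)"
        unfolding Sp_stab_def by (rule four_block_mat_mult_vec) (use that Ac in auto)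
      also have "0\<^sub>m ?n 2 *\<^sub>v d = 0\<^sub>v ?n" using that by (intro eq_vecI) auto
      also have "0\<^sub>m 2 ?n *\<^sub>v a = 0\<^sub>v 2" using that by (intro eq_vecI) auto
      finally show ?thesis using that Ac by simp
    qed
    have form: "symplectic_form (Suc h) (a @\<^sub>v d) (b @\<^sub>v e) =
        symplectic_form h a b + (d $ 0 * e $ 1 - d $ 1 * e $ 0)"
      if "a \<in> carrier_vec ?n" "b \<in> carrier_vec ?n" "d \<in> carrier_vec 2" "e \<in> carrier_vec 2" for a b d e :: "'a vec"
      using that by (auto simp: symplectic_form_def intro!: sum.cong)
    have "v \<in> carrier_vec (?n + 2)" using that(1) by simp
    then obtain a d where v: "a \<in> carrier_vec ?n" "d \<in> carrier_vec 2" "v = a @\<^sub>v d"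
      using vec_first_last_append[of v ?n 2] vec_first_carrier[of v ?n] vec_last_carrier[of v 2] by metis
    have "w \<in> carrier_vec (?n + 2)" using that(2) by simp
    then obtain b e where w: "b \<in> carrier_vec ?n" "e \<in> carrier_vec 2" "w = b @\<^sub>v e"
      using vec_first_last_append[of w ?n 2] vec_first_carrier[of w ?n] vec_last_carrier[of w 2] by metis
    show ?thesis
      using v w Ac by (simp add: app form sympl)
  qed
  ultimately show "Sp_stab h A \<in> carrier (Sp R (Suc h))"
    using Ac four_block_carrier_mat[of A ?n ?n "1\<^sub>m 2" 2 2] by (auto simp: Sp_def Sp_stab_def)
next
  fix A B assume "A \<in> carrier (Sp R h)" "B \<in> carrier (Sp R h)"
  then show "Sp_stab h (A \<otimes>\<^bsub>Sp R h\<^esub> B) = Sp_stab h A \<otimes>\<^bsub>Sp R (Suc h)\<^esub> Sp_stab h B"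
    using Sp_stab_mult[of A h B] by (auto simp: Sp_def)
qed

interpretation Sp: group_sequence "Sp R" Sp_stab for R :: "'a :: comm_ring_1 itself"
  by (rule group_sequence.intro, rule group_Sp, rule Sp_stab_hom)

theorem Sp_restriction_in_limit:
  assumes "X \<in> carrier (bounded_cohomology (Sp_infinity R) n)"
  shows "Sp_restriction R n X \<in> carrier (Sp_stable_bounded_cohomology R n)"
proof -
  have hom: "Sp_inclusion R h \<in> hom (Sp R h) (Sp_infinity R)" for h
    unfolding Sp_inclusion_def Sp_infinity_def by (rule Sp.colimit_inclusion_hom)
  have "bounded_cohomology_map (Sp R h) (Sp_stab h) n
      (bounded_cohomology_map (Sp R (Suc h)) (Sp_inclusion R (Suc h)) n X)
    = bounded_cohomology_map (Sp R h) (Sp_inclusion R h) n X" for h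
    by (rule bounded_cohomology_map_comp[OF group_Sp group_Sp Sp_stab_hom hom hom _ assms])
      (simp add: Sp_inclusion_def Sp.colimit_inclusion_step)
  then show ?thesis
    using bounded_cohomology_map_linear(1)[OF group_Sp hom assms assms]
    by (simp add: Sp_stable_bounded_cohomology_def sequential_limit_def Sp_restriction_def)
qed

end

theory Submission
  imports Defs "Jordan_Normal_Form.Determinant"
begin

text \<open>The group \<open>Sp\<^sub>2\<^sub>h(R)\<close> acts on the complex \<open>h \<times> h\<close> matrices \<open>Z\<close> with positive imaginary part.
  The argument \<open>kappa Z W\<close> of \<open>det (\<i> (Z\<^sup>* - W))\<close>, taken as a sum of arguments of pivots, is defined
  without ambiguity because the matrix is accretive. The coboundary of \<open>kappa\<close> along the orbit of
  \<open>\<i> 1\<close> is invariant and bounded, and it restricts strictly along stabilization: it is a Maslov cocycle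
  and defines a stable class in degree two.

  If this class came from a cocycle on \<open>Sp\<^sub>\<infinity>(R)\<close> bounded by \<open>C\<close>, then for every \<open>h\<close> the Maslov cocycle on
  \<open>Sp\<^sub>2\<^sub>h(R)\<close> would be cohomologous to one bounded by \<open>C\<close>, uniformly in \<open>h\<close>. But on the diagonal
  \<open>SL\<^sub>2(\<int>)\<close> in \<open>Sp\<^sub>2\<^sub>h(R)\<close> it is \<open>h\<close> times a fixed cocycle. Averaging over powers of elements yields a
  quantity that depends only on the cohomology class up to an error that vanishes in the limit, is
  bounded by a multiple of \<open>C\<close>, and equals \<open>h\<close> times a nonzero constant.\<close>

section \<open>The argument of the determinant of an accretive matrix\<close>

text \<open>The principal argument on the right half plane. Elsewhere the value is no argument but
  still lies in (-pi/2, pi/2), so \<open>arg_det_bound\<close> holds for every matrix.\<close>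

definition ang :: "complex \<Rightarrow> real" where
  "ang z = arctan (Im z / Re z)"

lemma ang_bound: "\<bar>ang z\<bar> < pi / 2"
  using arctan_bounded[of "Im z / Re z"] by (auto simp: ang_def)

lemma cis_ang:
  assumes "Re z > 0"
  shows "complex_of_real (cmod z) * cis (ang z) = z"
proof -
  have "sqrt (1 + (Im z / Re z)\<^sup>2) = cmod z / Re z"
  proof -
    have "1 + (Im z / Re z)\<^sup>2 = (cmod z / Re z)\<^sup>2"
      using assms by (simp add: cmod_power2 power_divide field_simps)
    then show ?thesis using assms by simp
  qed
  moreover have "cmod z \<noteq> 0" using assms by auto
  ultimately show ?thesis using assms
    by (simp add: complex_eq_iff ang_def cos_arctan sin_arctan)
qed

lemma ang_of_real_mult: "r > 0 \<Longrightarrow> ang (complex_of_real r * z) = ang z"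
  by (simp add: ang_def)

lemma ang_real: "Im z = 0 \<Longrightarrow> ang z = 0"
  by (simp add: ang_def)

definition lead :: "nat \<Rightarrow> 'a mat \<Rightarrow> 'a mat" where
  "lead k M = mat k k (\<lambda>ij. M $$ ij)"

lemma lead_carrier [simp]: "lead k M \<in> carrier_mat k k"
  by (simp add: lead_def)

lemma lead_self: "M \<in> carrier_mat n n \<Longrightarrow> lead n M = M"
  by (auto simp: lead_def)

text \<open>Vectors are functions of which only the first \<open>n\<close> values count, so a
  shorter vector becomes a longer one by padding with zeros.\<close>

definition bil :: "nat \<Rightarrow> complex mat \<Rightarrow> (nat \<Rightarrow> complex) \<Rightarrow> (nat \<Rightarrow> complex) \<Rightarrow> complex" where
  "bil n M x y = (\<Sum>i<n. \<Sum>j<n. cnj (x i) * M $$ (i, j) * y j)"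

definition accretive :: "nat \<Rightarrow> complex mat \<Rightarrow> bool" where
  "accretive n M \<longleftrightarrow> (\<forall>x. (\<exists>i<n. x i \<noteq> 0) \<longrightarrow> Re (bil n M x x) > 0)"

text \<open>The Gaussian pivot is the quotient of consecutive leading minors. Multiplying by the
  conjugate instead of dividing changes it by a positive factor when the smaller minor is nonzero,
  hence keeps its argument.\<close>

definition pivot :: "complex mat \<Rightarrow> nat \<Rightarrow> complex" where
  "pivot M k = det (lead (Suc k) M) * cnj (det (lead k M))"

text \<open>The minors telescope, so on accretive matrices this is the argument of
  \<open>det M\<close> modulo 2 pi. It may leave (-pi, pi], which is the price of its
  continuity.\<close>

definition arg_det :: "nat \<Rightarrow> complex mat \<Rightarrow> real" where
  "arg_det n M = (\<Sum>k<n. ang (pivot M k))"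

lemma arg_det_bound: "\<bar>arg_det n M\<bar> \<le> real n * (pi / 2)"
proof -
  have "\<bar>arg_det n M\<bar> \<le> (\<Sum>k<n. \<bar>ang (pivot M k)\<bar>)"
    unfolding arg_det_def by (rule sum_abs)
  also have "\<dots> \<le> (\<Sum>k<n. pi / 2)"
    by (rule sum_mono) (use ang_bound in \<open>auto intro: less_imp_le\<close>)
  finally show ?thesis by simp
qed

text \<open>The last column \<open>x\<close> of the adjugate of a leading block \<open>L\<close> of size \<open>k + 1\<close> satisfies
  \<open>x\<^sup>* L x = cnj (x k) det L\<close>, and \<open>x k\<close> is the previous leading minor.\<close>

lemma accretive_pivot_step:
  assumes "accretive n M" "l < n" "det (lead l M) \<noteq> 0"
  shows "Re (pivot M l) > 0"
proof -
  define L where "L = lead (Suc l) M"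
  define A where "A = adj_mat L"
  \<comment> \<open>Padded with zeros to length \<open>n\<close>, so that accretivity of all of
    \<open>M\<close> applies.\<close>
  define x where "x = (\<lambda>i. if i < Suc l then A $$ (i, l) else 0)"
  have L: "L \<in> carrier_mat (Suc l) (Suc l)" by (simp add: L_def)
  have A: "A \<in> carrier_mat (Suc l) (Suc l)" "L * A = det L \<cdot>\<^sub>m 1\<^sub>m (Suc l)"
    using adj_mat[OF L] by (auto simp: A_def)
  have xl: "x l = det (lead l M)"
  proof -
    have "mat_delete L l l = lead l M"
      by (rule eq_matI) (auto simp: mat_delete_def L_def lead_def)
    then show ?thesis using L by (simp add: x_def A_def adj_mat_def cofactor_def)
  qed
  have "Re (bil n M x x) > 0"
    using assms xl unfolding accretive_def by metis
  also have "bil n M x x = (\<Sum>i<Suc l. \<Sum>j<Suc l. cnj (x i) * M $$ (i, j) * x j)"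
  proof -
    have sub: "{..<Suc l} \<subseteq> {..<n}" using assms(2) by auto
    have "bil n M x x = (\<Sum>i<Suc l. \<Sum>j<n. cnj (x i) * M $$ (i, j) * x j)"
      unfolding bil_def by (rule sum.mono_neutral_right) (use sub in \<open>auto simp: x_def\<close>)
    also have "\<dots> = (\<Sum>i<Suc l. \<Sum>j<Suc l. cnj (x i) * M $$ (i, j) * x j)"
      by (intro sum.cong refl sum.mono_neutral_right) (use sub in \<open>auto simp: x_def\<close>)
    finally show ?thesis .
  qed
  also have "\<dots> = (\<Sum>i<Suc l. cnj (x i) * (L * A) $$ (i, l))"
  proof (rule sum.cong[OF refl])
    fix i assume i: "i \<in> {..<Suc l}"
    have "(L * A) $$ (i, l) = (\<Sum>j<Suc l. L $$ (i, j) * A $$ (j, l))"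
      using i L A(1) by (simp add: scalar_prod_def atLeast0LessThan del: sum.lessThan_Suc)
    also have "\<dots> = (\<Sum>j<Suc l. M $$ (i, j) * x j)"
      by (rule sum.cong[OF refl]) (use i in \<open>auto simp: L_def lead_def x_def\<close>)
    finally show "(\<Sum>j<Suc l. cnj (x i) * M $$ (i, j) * x j) = cnj (x i) * (L * A) $$ (i, l)"
      by (simp add: sum_distrib_left mult.assoc del: sum.lessThan_Suc)
  qed
  also have "\<dots> = (\<Sum>i<Suc l. if i = l then cnj (x i) * det L else 0)"
    by (rule sum.cong[OF refl]) (auto simp: A(2))
  also have "\<dots> = pivot M l"
    by (simp add: xl pivot_def L_def)
  finally show ?thesis .
qed

text \<open>A pivot with positive real part is nonzero, hence so is the next leading minor, which is
  what \<open>accretive_pivot_step\<close> asks for at the next index. The empty minor is 1.\<close>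

lemma accretive_pivot_pos:
  assumes "accretive n M" "k < n"
  shows "Re (pivot M k) > 0"
  using assms(2)
proof (induction k)
  case 0
  then show ?case by (intro accretive_pivot_step[OF assms(1)]) auto
next
  case (Suc k)
  then show ?case by (intro accretive_pivot_step[OF assms(1)]) (auto simp: pivot_def)
qed

lemma accretive_det_lead:
  assumes "accretive n M" "k \<le> n"
  shows "det (lead k M) = cmod (det (lead k M)) * cis (\<Sum>j<k. ang (pivot M j)) \<and> det (lead k M) \<noteq> 0"
  using assms(2)
proof (induction k)
  case 0
  then show ?case by simp
next
  case (Suc k)
  let ?d = "det (lead k M)" and ?e = "det (lead (Suc k) M)" and ?s = "\<Sum>j<k. ang (pivot M j)"
  have pos: "Re (pivot M k) > 0" using accretive_pivot_pos[OF assms(1)] Suc.prems by simp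
  have d: "?d = cmod ?d * cis ?s" "?d \<noteq> 0" using Suc by auto
  have e: "?e \<noteq> 0" using pos by (auto simp: pivot_def)
  have "?e * cnj ?d = cmod (?e * cnj ?d) * cis (ang (pivot M k))"
    using cis_ang[OF pos] by (simp add: pivot_def)
  \<comment> \<open>Multiplying by the previous minor turns its conjugate into a squared modulus,
    which cancels below.\<close>
  then have "?e * (?d * cnj ?d) = cmod (?e * cnj ?d) * cis (ang (pivot M k)) * ?d"
    by (metis mult.assoc mult.commute)
  also have "\<dots> = cmod (?e * cnj ?d) * cis (ang (pivot M k)) * (cmod ?d * cis ?s)"
    by (rule arg_cong[where f = "(*) _"]) (rule d(1))
  also have "\<dots> = cmod ?e * (cis (ang (pivot M k)) * cis ?s) * (complex_of_real (cmod ?d))\<^sup>2"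
    by (simp only: norm_mult complex_mod_cnj of_real_mult power2_eq_square mult_ac)
  finally have "?e * (complex_of_real (cmod ?d))\<^sup>2
      = cmod ?e * cis (ang (pivot M k) + ?s) * (complex_of_real (cmod ?d))\<^sup>2"
    by (simp only: complex_norm_square[symmetric] cis_mult of_real_power)
  moreover have "(complex_of_real (cmod ?d))\<^sup>2 \<noteq> 0" using d(2) by simp
  ultimately have "?e = cmod ?e * cis (ang (pivot M k) + ?s)"
    by (metis mult_right_cancel)
  moreover have "(\<Sum>j<Suc k. ang (pivot M j)) = ang (pivot M k) + ?s" by simp
  ultimately show ?case using e by metis
qed

lemma accretive_det:
  assumes "accretive n M" "M \<in> carrier_mat n n"
  shows "det M = cmod (det M) * cis (arg_det n M)" "det M \<noteq> 0"
  using accretive_det_lead[OF assms(1) order_refl] unfolding arg_det_def lead_self[OF assms(2)]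
  by blast+

lemma det_cnj: "det (map_mat cnj M) = cnj (det M)"
proof -
  interpret comm_ring_hom cnj by unfold_locales auto
  show ?thesis by (rule hom_det)
qed

text \<open>Leading minors of a Hermitian matrix are real, and so are its pivots.\<close>

lemma arg_det_hermitian:
  assumes "\<And>i j. i < n \<Longrightarrow> j < n \<Longrightarrow> M $$ (j, i) = cnj (M $$ (i, j))"
  shows "arg_det n M = 0"
proof -
  have "Im (det (lead k M)) = 0" if "k \<le> n" for k
  proof -
    have "transpose_mat (lead k M) = map_mat cnj (lead k M)"
    proof (rule eq_matI)
      fix i j assume "i < dim_row (map_mat cnj (lead k M))" "j < dim_col (map_mat cnj (lead k M))"
      then show "transpose_mat (lead k M) $$ (i, j) = map_mat cnj (lead k M) $$ (i, j)"
        using assms[of i j] that by (simp add: lead_def)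
    qed (simp_all add: lead_def)
    then have "cnj (det (lead k M)) = det (lead k M)"
      using det_transpose[OF lead_carrier[of k M]] det_cnj[of "lead k M"] by metis
    then show ?thesis by (metis Reals_cnj_iff complex_is_Real_iff)
  qed
  then show ?thesis by (simp add: arg_det_def pivot_def ang_real)
qed


section \<open>The generalised upper half plane\<close>

text \<open>The Gram matrix of the frames of \<open>Z\<close> and \<open>W\<close> under an
  indefinite Hermitian form, see \<open>herm_fr\<close>. For \<open>Z = W\<close> it is twice the
  imaginary part of \<open>Z\<close>.\<close>

definition pairm :: "nat \<Rightarrow> complex mat \<Rightarrow> complex mat \<Rightarrow> complex mat" where
  "pairm n Z W = mat n n (\<lambda>(i, j). \<i> * (cnj (Z $$ (j, i)) - W $$ (i, j)))"

lemma pairm_carrier [simp]: "pairm n Z W \<in> carrier_mat n n"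
  by (simp add: pairm_def)

lemma bil_pairm: "bil n (pairm n Z W) x x = \<i> * (cnj (bil n Z x x) - bil n W x x)"
proof -
  have "cnj (bil n Z x x) = (\<Sum>i<n. \<Sum>j<n. x i * cnj (Z $$ (i, j)) * cnj (x j))"
    by (simp add: bil_def)
  also have "\<dots> = (\<Sum>i<n. \<Sum>j<n. cnj (x i) * cnj (Z $$ (j, i)) * x j)"
    by (subst sum.swap) (simp add: mult_ac)
  finally show ?thesis
    by (simp add: bil_def pairm_def sum_subtractf sum_distrib_left algebra_simps)
qed

text \<open>Symmetry of \<open>Z\<close> is not demanded: this is the domain of the unitary group of
  signature (n, n), which contains the Siegel upper half space.\<close>

definition uhp :: "nat \<Rightarrow> complex mat \<Rightarrow> bool" where
  "uhp n Z \<longleftrightarrow> Z \<in> carrier_mat n n \<and> accretive n (pairm n Z Z)"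

lemma uhp_iff:
  "uhp n Z \<longleftrightarrow> Z \<in> carrier_mat n n \<and> (\<forall>x. (\<exists>i<n. x i \<noteq> 0) \<longrightarrow> Im (bil n Z x x) > 0)"
  by (simp add: uhp_def accretive_def bil_pairm)

lemma uhp_carrier: "uhp n Z \<Longrightarrow> Z \<in> carrier_mat n n"
  by (simp add: uhp_def)

lemma accretive_pairm: "uhp n Z \<Longrightarrow> uhp n W \<Longrightarrow> accretive n (pairm n Z W)"
  by (auto simp: uhp_iff accretive_def bil_pairm add_pos_pos)

definition segment_mat :: "nat \<Rightarrow> complex mat \<Rightarrow> complex mat \<Rightarrow> real \<Rightarrow> complex mat" where
  "segment_mat n Z W t = mat n n (\<lambda>ij. of_real (1 - t) * Z $$ ij + of_real t * W $$ ij)"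

text \<open>The imaginary part of the quadratic form depends affinely on the matrix, so the domain
  is convex.\<close>

lemma uhp_segment:
  assumes "uhp n Z" "uhp n W" "0 \<le> t" "t \<le> 1"
  shows "uhp n (segment_mat n Z W t)"
proof -
  have b: "bil n (segment_mat n Z W t) x x = of_real (1 - t) * bil n Z x x + of_real t * bil n W x x" for x
    by (simp add: bil_def segment_mat_def sum_distrib_left sum.distrib[symmetric] algebra_simps
        del: of_real_diff)
  have "Im (bil n (segment_mat n Z W t) x x) > 0" if "\<exists>i<n. x i \<noteq> 0" for x
  proof -
    have "Im (bil n Z x x) > 0" "Im (bil n W x x) > 0"
      using assms that by (auto simp: uhp_iff)
    then have "(1 - t) * Im (bil n Z x x) + t * Im (bil n W x x) > 0"
      using assms(3,4) by (cases "t = 0") (auto intro: add_nonneg_pos)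
    then show ?thesis unfolding b by (simp del: of_real_diff)
  qed
  then show ?thesis by (simp add: uhp_iff segment_mat_def)
qed

section \<open>The argument \<open>kappa\<close> and its alternating sum
  \<open>triple\<close>\<close>

definition kappa :: "nat \<Rightarrow> complex mat \<Rightarrow> complex mat \<Rightarrow> real" where
  "kappa n Z W = arg_det n (pairm n Z W)"

lemma kappa_bound: "\<bar>kappa n Z W\<bar> \<le> real n * (pi / 2)"
  by (simp add: kappa_def arg_det_bound del: times_divide_eq_right)

lemma kappa_same: "kappa n Z Z = 0"
  unfolding kappa_def by (rule arg_det_hermitian) (simp add: pairm_def algebra_simps)

definition triple :: "nat \<Rightarrow> complex mat \<Rightarrow> complex mat \<Rightarrow> complex mat \<Rightarrow> real" where
  "triple n Z0 Z1 Z2 = kappa n Z1 Z2 - kappa n Z0 Z2 + kappa n Z0 Z1"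

lemma triple_bound: "\<bar>triple n Z0 Z1 Z2\<bar> \<le> 3 * (real n * (pi / 2))"
  using kappa_bound[of n Z1 Z2] kappa_bound[of n Z0 Z2] kappa_bound[of n Z0 Z1]
  unfolding triple_def by linarith

lemma sgn_cnj: "sgn (cnj z) = cnj (sgn z)"
  by (simp add: sgn_eq)

lemma cis_kappa:
  assumes "uhp n Z" "uhp n W"
  shows "cis (kappa n Z W) = sgn (det (pairm n Z W))"
proof -
  note d = accretive_det[OF accretive_pairm[OF assms] pairm_carrier]
  show ?thesis
    using d(2) by (subst d(1)) (simp add: kappa_def sgn_mult sgn_of_real sgn_eq[of "cis _"])
qed

text \<open>A change of frames alters \<open>kappa\<close> modulo 2 pi by a difference of two
  arguments, one for each point. Such differences cancel in \<open>triple\<close>.\<close>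

lemma cis_kappa_diff:
  assumes "uhp n Z0" "uhp n Z1" "uhp n W0" "uhp n W1"
    and "det (pairm n Z0 Z1) = cnj q0 * det (pairm n W0 W1) * q1"
  shows "cis (kappa n Z0 Z1 - kappa n W0 W1) = cnj (sgn q0) * sgn q1"
proof -
  have "cis (kappa n Z0 Z1) = cnj (sgn q0) * cis (kappa n W0 W1) * sgn q1"
    using assms by (simp add: cis_kappa sgn_mult sgn_cnj)
  then show ?thesis by (simp add: cis_divide[symmetric])
qed

text \<open>The scalars \<open>q0\<close>, \<open>q1\<close>, \<open>q2\<close> record a change of frames; they contribute the positive factor
  \<open>\<bar>q0 q1 q2\<bar>\<^sup>2\<close> to the product of the three determinants.\<close>

lemma triple_diff_int:
  assumes "uhp n Z0" "uhp n Z1" "uhp n Z2" "uhp n W0" "uhp n W1" "uhp n W2"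
    and q: "q0 \<noteq> 0" "q1 \<noteq> 0" "q2 \<noteq> 0"
    and "det (pairm n Z0 Z1) = cnj q0 * det (pairm n W0 W1) * q1"
    and "det (pairm n Z1 Z2) = cnj q1 * det (pairm n W1 W2) * q2"
    and "det (pairm n Z0 Z2) = cnj q0 * det (pairm n W0 W2) * q2"
  shows "\<exists>m::int. triple n Z0 Z1 Z2 - triple n W0 W1 W2 = of_int m * (2 * pi)"
proof -
  define a b c where "a = kappa n Z0 Z1 - kappa n W0 W1" and "b = kappa n Z1 Z2 - kappa n W1 W2"
    and "c = kappa n Z0 Z2 - kappa n W0 W2"
  have e: "cis a = cnj (sgn q0) * sgn q1" "cis b = cnj (sgn q1) * sgn q2" "cis c = cnj (sgn q0) * sgn q2"
    unfolding a_def b_def c_def by (rule cis_kappa_diff; use assms in simp)+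
  have u: "cnj (sgn q) * sgn q = 1" if "q \<noteq> 0" for q :: complex
    using that by (metis complex_norm_square mult.commute norm_sgn of_real_1 power_one)
  have "cis (b - c + a) = cis b * cnj (cis c) * cis a"
    by (simp add: cis_mult cis_cnj)
  also have "\<dots> = (cnj (sgn q0) * sgn q0) * (cnj (sgn q1) * sgn q1) * (cnj (sgn q2) * sgn q2)"
    unfolding e by (simp add: mult_ac)
  also have "\<dots> = 1" using u q by simp
  finally have "cos (b - c + a) = 1" by (simp add: complex_eq_iff)
  moreover have "triple n Z0 Z1 Z2 - triple n W0 W1 W2 = b - c + a"
    by (simp add: triple_def a_def b_def c_def)
  ultimately show ?thesis by (auto simp: cos_one_2pi_int)
qed


section \<open>Paths of matrices\<close>

text \<open>Entrywise continuity suffices, since products, determinants and adjugates are polynomial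
  in the entries.\<close>

definition cont_mat :: "nat \<Rightarrow> nat \<Rightarrow> (real \<Rightarrow> complex mat) \<Rightarrow> bool" where
  "cont_mat m n F \<longleftrightarrow> (\<forall>t\<in>{0..1}. F t \<in> carrier_mat m n) \<and>
     (\<forall>i<m. \<forall>j<n. continuous_on {0..1} (\<lambda>t. F t $$ (i, j)))"

lemma cont_matI:
  assumes "\<And>t. t \<in> {0..1} \<Longrightarrow> F t \<in> carrier_mat m n"
    and "\<And>i j. i < m \<Longrightarrow> j < n \<Longrightarrow> continuous_on {0..1} (\<lambda>t. F t $$ (i, j))"
  shows "cont_mat m n F"
  using assms by (simp add: cont_mat_def)

lemma cont_mat_mult:
  assumes F: "cont_mat m k F" and G: "cont_mat k n G"
  shows "cont_mat m n (\<lambda>t. F t * G t)"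
proof (rule cont_matI)
  fix t :: real assume "t \<in> {0..1}"
  then show "F t * G t \<in> carrier_mat m n" using F G by (auto simp: cont_mat_def intro!: mult_carrier_mat[of _ m k])
next
  fix i j assume ij: "i < m" "j < n"
  have "continuous_on {0..1} (\<lambda>t. \<Sum>l<k. F t $$ (i, l) * G t $$ (l, j))"
    using ij F G by (intro continuous_intros) (auto simp: cont_mat_def)
  moreover have "(\<Sum>l<k. F t $$ (i, l) * G t $$ (l, j)) = (F t * G t) $$ (i, j)" if "t \<in> {0..1}" for t
  proof -
    have "F t \<in> carrier_mat m k" "G t \<in> carrier_mat k n" using F G that by (auto simp: cont_mat_def)
    then show ?thesis using ij by (simp add: scalar_prod_def atLeast0LessThan)
  qed
  ultimately show "continuous_on {0..1} (\<lambda>t. (F t * G t) $$ (i, j))"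
    by (rule continuous_on_cong[OF refl, THEN iffD1, rotated])
qed

lemma cont_det:
  assumes "cont_mat n n F"
  shows "continuous_on {0..1} (\<lambda>t. det (F t))"
proof -
  have "continuous_on {0..1} (\<lambda>t. \<Sum>p\<in>{p. p permutes {0..<n}}. signof p * (\<Prod>i = 0..<n. F t $$ (i, p i)))"
  proof (intro continuous_intros)
    fix p i assume "p \<in> {p. p permutes {0..<n}}" "i \<in> {0..<n}"
    then have "i < n" "p i < n"
      using permutes_in_image[of p "{0..<n}" i] by auto
    then show "continuous_on {0..1} (\<lambda>t. F t $$ (i, p i))" using assms by (auto simp: cont_mat_def)
  qed
  moreover have "(\<Sum>p\<in>{p. p permutes {0..<n}}. signof p * (\<Prod>i = 0..<n. F t $$ (i, p i))) = det (F t)"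
    if "t \<in> {0..1}" for t
    by (rule det_def'[symmetric]) (use assms that in \<open>auto simp: cont_mat_def\<close>)
  ultimately show ?thesis by (rule continuous_on_cong[OF refl, THEN iffD1, rotated])
qed

lemma cont_adj:
  assumes "cont_mat n n F"
  shows "cont_mat n n (\<lambda>t. adj_mat (F t))"
proof (rule cont_matI)
  fix t :: real assume "t \<in> {0..1}"
  then show "adj_mat (F t) \<in> carrier_mat n n" using assms by (auto simp: cont_mat_def intro: adj_mat)
next
  fix i j assume ij: "i < n" "j < n"
  have "cont_mat (n - 1) (n - 1) (\<lambda>t. mat_delete (F t) j i)"
  proof (rule cont_matI)
    fix t :: real assume "t \<in> {0..1}"
    then have "F t \<in> carrier_mat n n" using assms by (auto simp: cont_mat_def)
    then show "mat_delete (F t) j i \<in> carrier_mat (n - 1) (n - 1)"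
      by (rule mat_delete_carrier)
  next
    fix k l assume kl: "k < n - 1" "l < n - 1"
    have "continuous_on {0..1} (\<lambda>t. F t $$ (if k < j then k else Suc k, if l < i then l else Suc l))"
      using assms kl ij by (auto simp: cont_mat_def)
    moreover have "F t $$ (if k < j then k else Suc k, if l < i then l else Suc l) = mat_delete (F t) j i $$ (k, l)"
      if "t \<in> {0..1}" for t
    proof -
      have "F t \<in> carrier_mat n n" using assms that by (auto simp: cont_mat_def)
      then show ?thesis using kl by (simp add: mat_delete_def)
    qed
    ultimately show "continuous_on {0..1} (\<lambda>t. mat_delete (F t) j i $$ (k, l))"
      by (rule continuous_on_cong[OF refl, THEN iffD1, rotated])
  qed
  then have "continuous_on {0..1} (\<lambda>t. (-1) ^ (j + i) * det (mat_delete (F t) j i))"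
    by (intro continuous_intros cont_det)
  moreover have "(-1) ^ (j + i) * det (mat_delete (F t) j i) = adj_mat (F t) $$ (i, j)"
    if "t \<in> {0..1}" for t
  proof -
    have "F t \<in> carrier_mat n n" using assms that by (auto simp: cont_mat_def)
    then show ?thesis using ij by (simp add: adj_mat_def cofactor_def)
  qed
  ultimately show "continuous_on {0..1} (\<lambda>t. adj_mat (F t) $$ (i, j))"
    by (rule continuous_on_cong[OF refl, THEN iffD1, rotated])
qed

lemma cont_segment: "cont_mat n n (segment_mat n Z W)"
  by (rule cont_matI) (auto simp: segment_mat_def intro!: continuous_intros)

lemma cont_ang:
  assumes "continuous_on S f" "\<And>t. t \<in> S \<Longrightarrow> Re (f t) > 0"
  shows "continuous_on S (\<lambda>t. ang (f t))"
  unfolding ang_def using assms by (intro continuous_intros) force+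

text \<open>The pivots of an accretive matrix stay in the right half plane, where \<open>ang\<close>
  is continuous, so no jump by 2 pi can occur. This is the purpose of summing arguments of
  pivots.\<close>

lemma cont_kappa:
  assumes Z: "cont_mat n n Z" and W: "cont_mat n n W"
    and "\<And>t. t \<in> {0..1} \<Longrightarrow> uhp n (Z t)" "\<And>t. t \<in> {0..1} \<Longrightarrow> uhp n (W t)"
  shows "continuous_on {0..1} (\<lambda>t. kappa n (Z t) (W t))"
proof -
  have l: "continuous_on {0..1} (\<lambda>t. det (lead k (pairm n (Z t) (W t))))" if "k \<le> n" for k
  proof (rule cont_det, rule cont_matI)
    fix i j assume ij: "i < k" "j < k"
    have "continuous_on {0..1} (\<lambda>t. \<i> * (cnj (Z t $$ (j, i)) - W t $$ (i, j)))"
      using ij that Z W by (intro continuous_intros) (auto simp: cont_mat_def)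
    then show "continuous_on {0..1} (\<lambda>t. lead k (pairm n (Z t) (W t)) $$ (i, j))"
      using ij that by (simp add: lead_def pairm_def)
  qed simp
  have "continuous_on {0..1} (\<lambda>t. ang (pivot (pairm n (Z t) (W t)) k))" if "k < n" for k
  proof (rule cont_ang)
    show "continuous_on {0..1} (\<lambda>t. pivot (pairm n (Z t) (W t)) k)"
      unfolding pivot_def using that by (intro continuous_intros l) auto
  qed (use assms that in \<open>auto intro: accretive_pivot_pos accretive_pairm\<close>)
  then show ?thesis unfolding kappa_def arg_det_def by (intro continuous_intros) auto
qed

text \<open>By the intermediate value theorem all values between the endpoints would be integers,
  but a half-integer lies between any two distinct integers.\<close>

lemma int_valued_endpoints:
  fixes f :: "real \<Rightarrow> real"
  assumes "continuous_on {0..1} f" "\<And>t. t \<in> {0..1} \<Longrightarrow> f t \<in> \<int>"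
  shows "f 0 = f 1"
proof -
  have no: "y \<in> \<int>" if "f 0 \<le> y \<and> y \<le> f 1 \<or> f 1 \<le> y \<and> y \<le> f 0" for y
    using that IVT'[of f 0 y 1] IVT2'[of f 1 y 0] assms by auto
  obtain a b :: int where ab: "f 0 = of_int a" "f 1 = of_int b"
    using assms(2)[of 0] assms(2)[of 1] by (auto elim!: Ints_cases)
  have half: "of_int k + 1 / 2 \<notin> (\<int> :: real set)" for k :: int
  proof
    assume "of_int k + 1 / 2 \<in> (\<int> :: real set)"
    then obtain l :: int where "of_int k + 1 / 2 = (of_int l :: real)" by (auto elim: Ints_cases)
    then have "(of_int (2 * k + 1) :: real) = of_int (2 * l)" by simp
    then have "2 * k + 1 = 2 * l" by (simp only: of_int_eq_iff)
    then show False by presburger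
  qed
  show ?thesis
  proof (rule ccontr)
    assume "f 0 \<noteq> f 1"
    then have "real_of_int a + 1 \<le> of_int b \<or> real_of_int b + 1 \<le> of_int a"
      using ab by (auto simp: neq_iff)
    then show False
      using no[of "of_int a + 1 / 2"] no[of "of_int b + 1 / 2"] half ab by auto
  qed
qed


section \<open>The action of the symplectic group\<close>

text \<open>A basis of the graph of \<open>Z\<close>: the matrix \<open>Z\<close> stacked on the
  identity, with rows interleaved to match the basis order e1, f1, e2, f2. \<open>ev\<close> and
  \<open>od\<close> recover the two blocks.\<close>

definition fr :: "nat \<Rightarrow> complex mat \<Rightarrow> complex mat" where
  "fr n Z = mat (2 * n) n (\<lambda>(r, j). if even r then Z $$ (r div 2, j) else if r div 2 = j then 1 else 0)"

definition ev :: "nat \<Rightarrow> complex mat \<Rightarrow> complex mat" where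
  "ev n F = mat n n (\<lambda>(l, j). F $$ (2 * l, j))"

definition od :: "nat \<Rightarrow> complex mat \<Rightarrow> complex mat" where
  "od n F = mat n n (\<lambda>(l, j). F $$ (Suc (2 * l), j))"

lemma frame_carrier [simp]:
  "fr n Z \<in> carrier_mat (2 * n) n" "ev n F \<in> carrier_mat n n" "od n F \<in> carrier_mat n n"
  by (simp_all add: fr_def ev_def od_def)

lemma index_mult:
  "A \<in> carrier_mat m k \<Longrightarrow> B \<in> carrier_mat k n \<Longrightarrow> i < m \<Longrightarrow> j < n \<Longrightarrow>
    (A * B) $$ (i, j) = (\<Sum>l<k. A $$ (i, l) * B $$ (l, j))"
  by (simp add: scalar_prod_def atLeast0LessThan)

lemma ev_od_mult:
  assumes "F \<in> carrier_mat (2 * n) n" "Q \<in> carrier_mat n n"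
  shows "ev n (F * Q) = ev n F * Q" "od n (F * Q) = od n F * Q"
proof -
  show "ev n (F * Q) = ev n F * Q"
    by (rule eq_matI) (use assms in \<open>auto simp: ev_def scalar_prod_def\<close>)
  show "od n (F * Q) = od n F * Q"
    by (rule eq_matI) (use assms in \<open>auto simp: od_def scalar_prod_def\<close>)
qed

lemma ev_od_fr: "Z \<in> carrier_mat n n \<Longrightarrow> ev n (fr n Z) = Z" "od n (fr n Z) = 1\<^sub>m n"
  by (rule eq_matI; simp add: ev_def od_def fr_def)+

lemma frame_eqI:
  assumes "F \<in> carrier_mat (2 * n) n" "F' \<in> carrier_mat (2 * n) n"
    and "ev n F = ev n F'" "od n F = od n F'"
  shows "F = F'"
proof (rule eq_matI)
  fix r j assume "r < dim_row F'" "j < dim_col F'"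
  then have rj: "r div 2 < n" "j < n" using assms by auto
  have "ev n F $$ (r div 2, j) = ev n F' $$ (r div 2, j)" "od n F $$ (r div 2, j) = od n F' $$ (r div 2, j)"
    using assms by simp_all
  then show "F $$ (r, j) = F' $$ (r, j)"
    using rj by (cases "even r") (auto simp: ev_def od_def)
qed (use assms in auto)

text \<open>i times the sesquilinear extension of the symplectic form, on column \<open>a\<close> of
  \<open>X\<close> and column \<open>b\<close> of \<open>Y\<close>.\<close>

definition herm :: "nat \<Rightarrow> complex mat \<Rightarrow> complex mat \<Rightarrow> nat \<Rightarrow> nat \<Rightarrow> complex" where
  "herm n X Y a b =
     \<i> * (\<Sum>l<n. cnj (X $$ (2 * l, a)) * Y $$ (Suc (2 * l), b) - cnj (X $$ (Suc (2 * l), a)) * Y $$ (2 * l, b))"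

lemma herm_fr:
  assumes "a < n" "b < n"
  shows "herm n (fr n Z) (fr n W) a b = pairm n Z W $$ (a, b)"
proof -
  have "herm n (fr n Z) (fr n W) a b = \<i> * ((\<Sum>l<n. cnj (Z $$ (l, a)) * (if l = b then 1 else 0))
      - (\<Sum>l<n. (if l = a then 1 else 0) * W $$ (l, b)))"
    unfolding herm_def sum_subtractf[symmetric]
    by (intro arg_cong[where f = "(*) \<i>"] sum.cong refl) (use assms in \<open>auto simp: fr_def\<close>)
  also have "(\<Sum>l<n. cnj (Z $$ (l, a)) * (if l = b then 1 else 0)) = (\<Sum>l<n. if l = b then cnj (Z $$ (l, a)) else 0)"
    by (rule sum.cong) auto
  also have "(\<Sum>l<n. (if l = a then 1 else 0) * W $$ (l, b)) = (\<Sum>l<n. if l = a then W $$ (l, b) else 0)"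
    by (rule sum.cong) auto
  finally show ?thesis using assms by (simp add: pairm_def)
qed

lemma sum_product_expand:
  fixes f g x y :: "nat \<Rightarrow> complex"
  shows "cnj (\<Sum>c<m. f c * x c) * (\<Sum>d<m. g d * y d) = (\<Sum>c<m. \<Sum>d<m. cnj (x c) * (cnj (f c) * g d) * y d)"
  unfolding cnj_sum sum_product by (intro sum.cong refl) (simp add: mult_ac)

text \<open>The coefficients \<open>f\<close> and \<open>g\<close> are arbitrary, so that one
  identity serves both for a change of basis of the columns in \<open>herm_mult\<close> and for
  multiplication by a group element in \<open>herm_Sp\<close>.\<close>

lemma herm_expand:
  "\<i> * (\<Sum>l<n. cnj (\<Sum>c<m. f (2 * l) c * x c) * (\<Sum>d<m. g (Suc (2 * l)) d * y d)
        - cnj (\<Sum>c<m. f (Suc (2 * l)) c * x c) * (\<Sum>d<m. g (2 * l) d * y d))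
   = (\<Sum>c<m. \<Sum>d<m. cnj (x c) *
        (\<i> * (\<Sum>l<n. cnj (f (2 * l) c) * g (Suc (2 * l)) d - cnj (f (Suc (2 * l)) c) * g (2 * l) d)) * y d)"
  (is "?L = ?R")
proof -
  have "?L = (\<Sum>l<n. \<Sum>c<m. \<Sum>d<m. \<i> * (cnj (x c) *
      (cnj (f (2 * l) c) * g (Suc (2 * l)) d - cnj (f (Suc (2 * l)) c) * g (2 * l) d) * y d))"
    unfolding sum_product_expand
    by (simp add: sum_subtractf sum_distrib_left algebra_simps)
  also have "\<dots> = (\<Sum>c<m. \<Sum>l<n. \<Sum>d<m. \<i> * (cnj (x c) *
      (cnj (f (2 * l) c) * g (Suc (2 * l)) d - cnj (f (Suc (2 * l)) c) * g (2 * l) d) * y d))"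
    by (rule sum.swap)
  also have "\<dots> = (\<Sum>c<m. \<Sum>d<m. \<Sum>l<n. \<i> * (cnj (x c) *
      (cnj (f (2 * l) c) * g (Suc (2 * l)) d - cnj (f (Suc (2 * l)) c) * g (2 * l) d) * y d))"
    by (intro sum.cong refl sum.swap)
  also have "\<dots> = ?R"
    by (intro sum.cong refl) (simp add: sum_distrib_left sum_distrib_right mult_ac)
  finally show ?thesis .
qed

lemma herm_mult:
  assumes "X \<in> carrier_mat (2 * n) n" "Y \<in> carrier_mat (2 * n) n" "Q \<in> carrier_mat n n" "R \<in> carrier_mat n n"
    and "a < n" "b < n"
  shows "herm n (X * Q) (Y * R) a b
     = (\<Sum>c<n. \<Sum>d<n. cnj (Q $$ (c, a)) * herm n X Y c d * R $$ (d, b))"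
proof -
  have "herm n (X * Q) (Y * R) a b =
    \<i> * (\<Sum>l<n. cnj (\<Sum>c<n. X $$ (2 * l, c) * Q $$ (c, a)) * (\<Sum>d<n. Y $$ (Suc (2 * l), d) * R $$ (d, b))
        - cnj (\<Sum>c<n. X $$ (Suc (2 * l), c) * Q $$ (c, a)) * (\<Sum>d<n. Y $$ (2 * l, d) * R $$ (d, b)))"
    unfolding herm_def using assms
    by (intro arg_cong[where f = "(*) \<i>"] sum.cong refl) (simp add: index_mult[of _ "2 * n" n _ n] del: index_mult_mat(1))
  also have "\<dots> = (\<Sum>c<n. \<Sum>d<n. cnj (Q $$ (c, a)) * herm n X Y c d * R $$ (d, b))"
    unfolding herm_def
    by (rule herm_expand[where f = "\<lambda>r c. X $$ (r, c)" and g = "\<lambda>r c. Y $$ (r, c)"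
          and x = "\<lambda>c. Q $$ (c, a)" and y = "\<lambda>d. R $$ (d, b)"])
  finally show ?thesis .
qed

text \<open>The hypothesis is a matrix congruence in entries: the conjugate transpose of
  \<open>Q\<close> times \<open>N\<close> times \<open>R\<close>. This is the shape in which
  \<open>pairm_act\<close> delivers it.\<close>

lemma bil_congruence:
  assumes "\<And>c d. c < n \<Longrightarrow> d < n \<Longrightarrow> M $$ (c, d) = bil n N (\<lambda>i. Q $$ (i, c)) (\<lambda>j. R $$ (j, d))"
  shows "bil n M x y = bil n N (\<lambda>i. \<Sum>c<n. Q $$ (i, c) * x c) (\<lambda>j. \<Sum>d<n. R $$ (j, d) * y d)"
proof -
  have "bil n M x y = (\<Sum>c<n. \<Sum>d<n. \<Sum>i<n. \<Sum>j<n. cnj (Q $$ (i, c)) * N $$ (i, j) * R $$ (j, d) * (cnj (x c) * y d))"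
    unfolding bil_def
    by (intro sum.cong refl) (simp add: assms bil_def sum_distrib_left sum_distrib_right mult_ac)
  also have "\<dots> = (\<Sum>c<n. \<Sum>i<n. \<Sum>d<n. \<Sum>j<n. cnj (Q $$ (i, c)) * N $$ (i, j) * R $$ (j, d) * (cnj (x c) * y d))"
    by (intro sum.cong refl sum.swap)
  also have "\<dots> = (\<Sum>i<n. \<Sum>c<n. \<Sum>d<n. \<Sum>j<n. cnj (Q $$ (i, c)) * N $$ (i, j) * R $$ (j, d) * (cnj (x c) * y d))"
    by (rule sum.swap)
  also have "\<dots> = (\<Sum>i<n. \<Sum>c<n. \<Sum>j<n. \<Sum>d<n. cnj (Q $$ (i, c)) * N $$ (i, j) * R $$ (j, d) * (cnj (x c) * y d))"
    by (intro sum.cong refl sum.swap)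
  also have "\<dots> = (\<Sum>i<n. \<Sum>j<n. \<Sum>c<n. \<Sum>d<n. cnj (Q $$ (i, c)) * N $$ (i, j) * R $$ (j, d) * (cnj (x c) * y d))"
    by (intro sum.cong refl sum.swap)
  also have "\<dots> = (\<Sum>i<n. \<Sum>j<n. N $$ (i, j) * (cnj (\<Sum>c<n. Q $$ (i, c) * x c) * (\<Sum>d<n. R $$ (j, d) * y d)))"
    by (intro sum.cong refl) (simp add: sum_product sum_distrib_left mult_ac)
  also have "\<dots> = bil n N (\<lambda>i. \<Sum>c<n. Q $$ (i, c) * x c) (\<lambda>j. \<Sum>d<n. R $$ (j, d) * y d)"
    by (simp add: bil_def mult_ac)
  finally show ?thesis .
qed

lemma det_congruence:
  assumes M: "M \<in> carrier_mat n n" and N: "N \<in> carrier_mat n n"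
    and Q: "Q \<in> carrier_mat n n" and R: "R \<in> carrier_mat n n"
    and "\<And>c d. c < n \<Longrightarrow> d < n \<Longrightarrow> M $$ (c, d) = bil n N (\<lambda>i. Q $$ (i, c)) (\<lambda>j. R $$ (j, d))"
  shows "det M = cnj (det Q) * det N * det R"
proof -
  let ?S = "transpose_mat (map_mat cnj Q)"
  have S: "?S \<in> carrier_mat n n" using Q by simp
  have NR: "N * R \<in> carrier_mat n n" using N R by simp
  have "M = ?S * (N * R)"
  proof (rule eq_matI)
    fix c d assume "c < dim_row (?S * (N * R))" "d < dim_col (?S * (N * R))"
    then have cd: "c < n" "d < n" using S R by auto
    have "(?S * (N * R)) $$ (c, d) = (\<Sum>i<n. cnj (Q $$ (i, c)) * (\<Sum>j<n. N $$ (i, j) * R $$ (j, d)))"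
      unfolding index_mult[OF S NR cd]
      by (intro sum.cong refl) (use cd Q in \<open>simp add: index_mult[OF N R] del: index_mult_mat(1)\<close>)
    then show "M $$ (c, d) = (?S * (N * R)) $$ (c, d)"
      by (simp add: assms(5) cd bil_def sum_distrib_left mult_ac)
  qed (use M Q R in auto)
  then have "det M = det ?S * (det N * det R)"
    using det_mult[OF S NR] det_mult[OF N R] by simp
  moreover have "det ?S = cnj (det Q)"
    using det_transpose[of "map_mat cnj Q" n] det_cnj[of Q] Q by simp
  ultimately show ?thesis by simp
qed

text \<open>The adjugate formula makes continuity in the entries of \<open>Q\<close> visible, as
  \<open>cont_act\<close> needs.\<close>

definition minv :: "complex mat \<Rightarrow> complex mat" where
  "minv Q = inverse (det Q) \<cdot>\<^sub>m adj_mat Q"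

lemma minv:
  assumes "Q \<in> carrier_mat n n" "det Q \<noteq> 0"
  shows "minv Q \<in> carrier_mat n n" "Q * minv Q = 1\<^sub>m n" "minv Q * Q = 1\<^sub>m n"
proof -
  note a = adj_mat[OF assms(1)]
  show "minv Q \<in> carrier_mat n n" using a(1) by (simp add: minv_def)
  show "Q * minv Q = 1\<^sub>m n" unfolding minv_def
    using assms(2) by (simp add: mult_smult_distrib[OF assms(1) a(1)] a(2)) (auto intro!: eq_matI)
  show "minv Q * Q = 1\<^sub>m n" unfolding minv_def
    using assms(2) by (simp add: mult_smult_assoc_mat[OF a(1) assms(1)] a(3)) (auto intro!: eq_matI)
qed

text \<open>Covers the integers and the reals at once: what enters of the ring is a homomorphism
  into the complex numbers with real values.\<close>

locale real_embedding = comm_ring_hom emb for emb :: "'a :: comm_ring_1 \<Rightarrow> complex" +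
  assumes cnj_emb [simp]: "cnj (emb x) = emb x"
begin

definition frame_image :: "nat \<Rightarrow> 'a mat \<Rightarrow> complex mat \<Rightarrow> complex mat" where
  "frame_image n G Z = map_mat emb G * fr n Z"

abbreviation den :: "nat \<Rightarrow> 'a mat \<Rightarrow> complex mat \<Rightarrow> complex mat" where
  "den n G Z \<equiv> od n (frame_image n G Z)"

text \<open>The Moebius transformation (A Z + B) (C Z + D)^(-1), with \<open>den\<close> the
  automorphy factor C Z + D. It is read off by renormalising the transformed frame to lower block
  1.\<close>

definition act :: "nat \<Rightarrow> 'a mat \<Rightarrow> complex mat \<Rightarrow> complex mat" where
  "act n G Z = ev n (frame_image n G Z) * minv (den n G Z)"

lemma Sp_carrier_mat: "G \<in> carrier (Sp (R :: 'a itself) n) \<Longrightarrow> G \<in> carrier_mat (2 * n) (2 * n)"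
  by (simp add: Sp_def)

lemma frame_image_carrier: "G \<in> carrier_mat (2 * n) (2 * n) \<Longrightarrow> frame_image n G Z \<in> carrier_mat (2 * n) n"
  by (simp add: frame_image_def)

text \<open>Invariance of the form tested on unit vectors. The right side stays a sum of deltas, so
  that \<open>emb\<close> can be applied term by term.\<close>

lemma Sp_columns:
  assumes G: "G \<in> carrier (Sp (R :: 'a itself) n)" and ab: "a < 2 * n" "b < 2 * n"
  shows "(\<Sum>l<n. G $$ (2 * l, a) * G $$ (Suc (2 * l), b) - G $$ (Suc (2 * l), a) * G $$ (2 * l, b)) =
    (\<Sum>l<n. (if 2 * l = a then 1 else 0) * (if Suc (2 * l) = b then 1 else 0)
      - (if Suc (2 * l) = a then 1 else 0) * (if 2 * l = b then 1 else 0))"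
proof -
  have Gc: "G \<in> carrier_mat (2 * n) (2 * n)" using G by (rule Sp_carrier_mat)
  have u: "(G *\<^sub>v unit_vec (2 * n) c) $ i = G $$ (i, c)" if "i < 2 * n" "c < 2 * n" for i c
    using Gc that by simp
  have "symplectic_form n (G *\<^sub>v unit_vec (2 * n) a) (G *\<^sub>v unit_vec (2 * n) b)
      = symplectic_form n (unit_vec (2 * n) a) (unit_vec (2 * n) b)"
    using G by (simp add: Sp_def)
  moreover have "symplectic_form n (G *\<^sub>v unit_vec (2 * n) a) (G *\<^sub>v unit_vec (2 * n) b) =
    (\<Sum>l<n. G $$ (2 * l, a) * G $$ (Suc (2 * l), b) - G $$ (Suc (2 * l), a) * G $$ (2 * l, b))"
    unfolding symplectic_form_def using ab by (intro sum.cong refl) (simp add: u del: index_mult_mat_vec)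
  moreover have "symplectic_form n (unit_vec (2 * n) a) (unit_vec (2 * n) b :: 'a vec) =
    (\<Sum>l<n. (if 2 * l = a then 1 else 0) * (if Suc (2 * l) = b then 1 else 0)
      - (if Suc (2 * l) = a then 1 else 0) * (if 2 * l = b then 1 else 0))"
    unfolding symplectic_form_def using ab by (intro sum.cong refl) (auto simp: unit_vec_def)
  ultimately show ?thesis by simp
qed

text \<open>The entries of \<open>G\<close> are fixed by conjugation, so the symplectic relations
  between its columns carry over to the sesquilinear extension.\<close>

lemma herm_Sp:
  assumes G: "G \<in> carrier (Sp (R :: 'a itself) n)"
    and X: "X \<in> carrier_mat (2 * n) n" and Y: "Y \<in> carrier_mat (2 * n) n" and ab: "a < n" "b < n"
  shows "herm n (map_mat emb G * X) (map_mat emb G * Y) a b = herm n X Y a b"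
proof -
  define g where "g = (\<lambda>r c. emb (G $$ (r, c)))"
  \<comment> \<open>Coefficients of the identity matrix: both sides become instances of
    \<open>herm_expand\<close>, differing only in \<open>g\<close> against \<open>e\<close>.\<close>
  define e where "e = (\<lambda>(r :: nat) c. if r = c then 1 else 0 :: complex)"
  have Gc: "G \<in> carrier_mat (2 * n) (2 * n)" using G by (rule Sp_carrier_mat)
  then have Gm: "map_mat emb G \<in> carrier_mat (2 * n) (2 * n)" by simp
  have gX: "(map_mat emb G * X) $$ (r, c) = (\<Sum>d<2 * n. g r d * X $$ (d, c))"
    if "r < 2 * n" "c < n" "X \<in> carrier_mat (2 * n) n" for r c X
    unfolding index_mult[OF Gm that(3,1,2)] using Gc that by (intro sum.cong refl) (auto simp: g_def)
  have eX: "X $$ (r, c) = (\<Sum>d<2 * n. e r d * X $$ (d, c))" if "r < 2 * n" for r c and X :: "complex mat"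
  proof -
    have "(\<Sum>d<2 * n. e r d * X $$ (d, c)) = (\<Sum>d<2 * n. if d = r then X $$ (d, c) else 0)"
      by (intro sum.cong refl) (auto simp: e_def)
    then show ?thesis using that by simp
  qed
  have ge: "(\<Sum>l<n. cnj (g (2 * l) c) * g (Suc (2 * l)) d - cnj (g (Suc (2 * l)) c) * g (2 * l) d)
      = (\<Sum>l<n. cnj (e (2 * l) c) * e (Suc (2 * l)) d - cnj (e (Suc (2 * l)) c) * e (2 * l) d)"
    if "c < 2 * n" "d < 2 * n" for c d
  proof -
    have "(\<Sum>l<n. cnj (g (2 * l) c) * g (Suc (2 * l)) d - cnj (g (Suc (2 * l)) c) * g (2 * l) d)
      = emb (\<Sum>l<n. G $$ (2 * l, c) * G $$ (Suc (2 * l), d) - G $$ (Suc (2 * l), c) * G $$ (2 * l, d))"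
      by (simp add: g_def hom_sum hom_distribs)
    also have "\<dots> = (\<Sum>l<n. cnj (e (2 * l) c) * e (Suc (2 * l)) d - cnj (e (Suc (2 * l)) c) * e (2 * l) d)"
      unfolding Sp_columns[OF G that] hom_sum
      by (intro sum.cong refl) (auto simp: e_def hom_distribs)
    finally show ?thesis .
  qed
  note exg = herm_expand[where x = "\<lambda>c. X $$ (c, a)" and y = "\<lambda>d. Y $$ (d, b)" and m = "2 * n" and f = g and g = g]
  note exe = herm_expand[where x = "\<lambda>c. X $$ (c, a)" and y = "\<lambda>d. Y $$ (d, b)" and m = "2 * n" and f = e and g = e]
  have "herm n (map_mat emb G * X) (map_mat emb G * Y) a b =
    \<i> * (\<Sum>l<n. cnj (\<Sum>c<2*n. g (2 * l) c * X $$ (c, a)) * (\<Sum>d<2*n. g (Suc (2 * l)) d * Y $$ (d, b))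
        - cnj (\<Sum>c<2*n. g (Suc (2 * l)) c * X $$ (c, a)) * (\<Sum>d<2*n. g (2 * l) d * Y $$ (d, b)))"
    unfolding herm_def
    by (intro arg_cong[where f = "(*) \<i>"] sum.cong refl)
      (use ab X Y in \<open>simp add: gX del: index_mult_mat(1)\<close>)
  also have "\<dots> = \<i> * (\<Sum>l<n. cnj (\<Sum>c<2*n. e (2 * l) c * X $$ (c, a)) * (\<Sum>d<2*n. e (Suc (2 * l)) d * Y $$ (d, b))
        - cnj (\<Sum>c<2*n. e (Suc (2 * l)) c * X $$ (c, a)) * (\<Sum>d<2*n. e (2 * l) d * Y $$ (d, b)))"
    unfolding exg exe by (intro sum.cong refl) (simp add: ge)
  also have "\<dots> = herm n X Y a b"
    unfolding herm_def
    by (intro arg_cong[where f = "(*) \<i>"] sum.cong refl) (simp add: eX[symmetric])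
  finally show ?thesis .
qed

lemma pairm_frame_image:
  assumes "G \<in> carrier (Sp (R :: 'a itself) n)" "a < n" "b < n"
  shows "herm n (frame_image n G Z) (frame_image n G W) a b = pairm n Z W $$ (a, b)"
  unfolding frame_image_def using assms by (simp add: herm_Sp herm_fr)

text \<open>A kernel vector gives a combination of the columns whose odd coordinates vanish, hence
  an isotropic vector for \<open>herm\<close>. By invariance its value is that of the positive form
  of \<open>pairm n Z Z\<close> at the kernel vector.\<close>

lemma det_den:
  assumes G: "G \<in> carrier (Sp (R :: 'a itself) n)" and Z: "uhp n Z"
  shows "det (den n G Z) \<noteq> 0"
proof
  let ?F = "frame_image n G Z"
  have F: "?F \<in> carrier_mat (2 * n) n" using Sp_carrier_mat[OF G] by (rule frame_image_carrier)
  assume "det (den n G Z) = 0"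
  then obtain v where v: "v \<in> carrier_vec n" "v \<noteq> 0\<^sub>v n" "den n G Z *\<^sub>v v = 0\<^sub>v n"
    using det_0_iff_vec_prod_zero[of "den n G Z" n] by auto
  have ex: "\<exists>i<n. v $ i \<noteq> 0" using v(1,2) by (metis carrier_vecD eq_vecI index_zero_vec)
  then have n: "0 < n" by auto
  \<comment> \<open>All columns equal \<open>v\<close>, so that \<open>herm_mult\<close>, stated for
    square matrices, can be applied. Only column 0 is read.\<close>
  define Q where "Q = mat n n (\<lambda>(c, a). v $ c)"
  have Q: "Q \<in> carrier_mat n n" by (simp add: Q_def)
  have "(?F * Q) $$ (Suc (2 * l), 0) = 0" if "l < n" for l
  proof -
    have "(?F * Q) $$ (Suc (2 * l), 0) = (\<Sum>c<n. ?F $$ (Suc (2 * l), c) * v $ c)"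
      using index_mult[OF F Q, of "Suc (2 * l)" 0] that n by (simp add: Q_def)
    also have "\<dots> = (den n G Z *\<^sub>v v) $ l"
      using that v(1) by (auto simp: od_def scalar_prod_def atLeast0LessThan intro!: sum.cong)
    finally show ?thesis using v(3) that by simp
  qed
  then have "herm n (?F * Q) (?F * Q) 0 0 = 0" by (simp add: herm_def)
  moreover have "herm n (?F * Q) (?F * Q) 0 0 = bil n (pairm n Z Z) (($) v) (($) v)"
    unfolding herm_mult[OF F F Q Q n n] bil_def
    by (intro sum.cong refl) (use n in \<open>simp add: Q_def pairm_frame_image[OF G]\<close>)
  ultimately show False using Z ex unfolding uhp_def accretive_def by (metis less_irrefl zero_complex.sel(1))
qed

lemma act_eqI:
  assumes "W \<in> carrier_mat n n" "det (den n G Z) \<noteq> 0" "W * den n G Z = ev n (frame_image n G Z)"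
  shows "act n G Z = W"
proof -
  note m = minv[OF frame_carrier(3) assms(2)]
  have "act n G Z = W * (den n G Z * minv (den n G Z))"
    unfolding act_def assms(3)[symmetric] by (rule assoc_mult_mat[OF assms(1) frame_carrier(3) m(1)])
  then show ?thesis using m(2) assms(1) by simp
qed

lemma act_carrier:
  assumes "G \<in> carrier (Sp (R :: 'a itself) n)" "uhp n Z"
  shows "act n G Z \<in> carrier_mat n n"
  using minv(1)[OF frame_carrier(3) det_den[OF assms]] unfolding act_def
  by (intro mult_carrier_mat[of _ n n]) simp_all

lemma act_den:
  assumes "G \<in> carrier (Sp (R :: 'a itself) n)" "uhp n Z"
  shows "act n G Z * den n G Z = ev n (frame_image n G Z)"
proof -
  note m = minv[OF frame_carrier(3) det_den[OF assms]]
  have "act n G Z * den n G Z = ev n (frame_image n G Z) * (minv (den n G Z) * den n G Z)"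
    unfolding act_def by (rule assoc_mult_mat[OF frame_carrier(2) m(1) frame_carrier(3)])
  then show ?thesis unfolding m(3) by (simp add: right_mult_one_mat[OF frame_carrier(2)])
qed

text \<open>Links Moebius transformations to linear algebra: the image of a graph is again a graph,
  and \<open>den\<close> is the change of its basis.\<close>

lemma fr_act:
  assumes "G \<in> carrier (Sp (R :: 'a itself) n)" "uhp n Z"
  shows "frame_image n G Z = fr n (act n G Z) * den n G Z"
proof (rule frame_eqI)
  show "frame_image n G Z \<in> carrier_mat (2 * n) n"
    by (rule frame_image_carrier, rule Sp_carrier_mat, rule assms)
  show "fr n (act n G Z) * den n G Z \<in> carrier_mat (2 * n) n"
    by (rule mult_carrier_mat[OF frame_carrier(1) frame_carrier(3)])
  show "ev n (frame_image n G Z) = ev n (fr n (act n G Z) * den n G Z)"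
    by (simp add: ev_od_mult[OF frame_carrier(1,3)] ev_od_fr(1)[OF act_carrier[OF assms]] act_den[OF assms])
  show "den n G Z = od n (fr n (act n G Z) * den n G Z)"
    by (simp add: ev_od_mult[OF frame_carrier(1,3)] ev_od_fr(2) left_mult_one_mat[OF frame_carrier(3)])
qed

lemma pairm_act:
  assumes G: "G \<in> carrier (Sp (R :: 'a itself) n)" and "uhp n Z" "uhp n W" and ab: "a < n" "b < n"
  shows "pairm n Z W $$ (a, b) =
    bil n (pairm n (act n G Z) (act n G W)) (\<lambda>i. den n G Z $$ (i, a)) (\<lambda>j. den n G W $$ (j, b))"
proof -
  have "pairm n Z W $$ (a, b) = herm n (fr n (act n G Z) * den n G Z) (fr n (act n G W) * den n G W) a b"
    using assms by (simp add: pairm_frame_image[OF G, symmetric] fr_act[OF G, symmetric])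
  also have "\<dots> = bil n (pairm n (act n G Z) (act n G W)) (\<lambda>i. den n G Z $$ (i, a)) (\<lambda>j. den n G W $$ (j, b))"
    by (subst herm_mult) (use ab in \<open>auto simp: bil_def herm_fr\<close>)
  finally show ?thesis .
qed

text \<open>Provides the hypotheses of \<open>triple_diff_int\<close>, with the determinants of the
  automorphy factors as the scalars.\<close>

lemma det_pairm_act:
  assumes "G \<in> carrier (Sp (R :: 'a itself) n)" "uhp n Z" "uhp n W"
  shows "det (pairm n Z W) = cnj (det (den n G Z)) * det (pairm n (act n G Z) (act n G W)) * det (den n G W)"
  by (rule det_congruence[of _ n]) (simp_all add: pairm_act[OF assms])

text \<open>Positivity passes through the congruence by \<open>den\<close>, because
  \<open>den\<close> is invertible and so every \<open>w\<close> is the image of some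
  \<open>v\<close>.\<close>

lemma uhp_act:
  assumes G: "G \<in> carrier (Sp (R :: 'a itself) n)" and Z: "uhp n Z"
  shows "uhp n (act n G Z)"
  unfolding uhp_def accretive_def
proof (intro conjI allI impI act_carrier[OF assms])
  fix w :: "nat \<Rightarrow> complex" assume w: "\<exists>i<n. w i \<noteq> 0"
  let ?Q = "den n G Z"
  note m = minv[OF frame_carrier(3) det_den[OF assms]]
  define v where "v = (\<lambda>c. \<Sum>d<n. minv ?Q $$ (c, d) * w d)"
  have Qv: "(\<Sum>c<n. ?Q $$ (i, c) * v c) = w i" if i: "i < n" for i
  proof -
    have "(\<Sum>c<n. ?Q $$ (i, c) * v c) = (\<Sum>d<n. (\<Sum>c<n. ?Q $$ (i, c) * minv ?Q $$ (c, d)) * w d)"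
      unfolding v_def sum_distrib_left sum_distrib_right by (subst sum.swap) (simp add: mult_ac)
    also have "\<dots> = (\<Sum>d<n. if d = i then w d else 0)"
    proof (intro sum.cong refl)
      fix d assume "d \<in> {..<n}"
      then have "(\<Sum>c<n. ?Q $$ (i, c) * minv ?Q $$ (c, d)) = 1\<^sub>m n $$ (i, d)"
        using i index_mult[OF frame_carrier(3) m(1), of i d] m(2) by (metis lessThan_iff)
      then show "(\<Sum>c<n. ?Q $$ (i, c) * minv ?Q $$ (c, d)) * w d = (if d = i then w d else 0)"
        using i \<open>d \<in> {..<n}\<close> by simp
    qed
    finally show ?thesis using i by simp
  qed
  have "\<exists>i<n. v i \<noteq> 0"
  proof (rule ccontr)
    assume "\<not> ?thesis"
    then have "w i = 0" if "i < n" for i using Qv[OF that] by simp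
    then show False using w by auto
  qed
  then have "0 < Re (bil n (pairm n Z Z) v v)" using Z by (simp add: uhp_def accretive_def)
  also have "bil n (pairm n Z Z) v v = bil n (pairm n (act n G Z) (act n G Z))
      (\<lambda>i. \<Sum>c<n. ?Q $$ (i, c) * v c) (\<lambda>i. \<Sum>c<n. ?Q $$ (i, c) * v c)"
    by (rule bil_congruence) (simp add: pairm_act[OF G Z Z])
  also have "\<dots> = bil n (pairm n (act n G Z) (act n G Z)) w w"
    unfolding bil_def by (intro sum.cong refl) (simp add: Qv)
  finally show "0 < Re (bil n (pairm n (act n G Z) (act n G Z)) w w)" .
qed

text \<open>The automorphy factor of a product is the product of the factors at the moved and at the
  original point. The even blocks then match by associativity.\<close>

lemma act_act:
  assumes G: "G \<in> carrier (Sp (R :: 'a itself) n)" and K: "K \<in> carrier (Sp R n)" and Z: "uhp n Z"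
  shows "act n (K * G) Z = act n K (act n G Z)"
proof (rule act_eqI)
  let ?W = "act n G Z"
  note W = uhp_act[OF G Z]
  have c: "map_mat emb K \<in> carrier_mat (2 * n) (2 * n)" "map_mat emb G \<in> carrier_mat (2 * n) (2 * n)"
    using Sp_carrier_mat[OF G] Sp_carrier_mat[OF K] by simp_all
  note f = frame_image_carrier[OF Sp_carrier_mat[OF K], of ?W]
  have "frame_image n (K * G) Z = map_mat emb K * frame_image n G Z"
    unfolding frame_image_def
    by (simp add: mat_hom_mult[OF Sp_carrier_mat[OF K] Sp_carrier_mat[OF G]] assoc_mult_mat[OF c frame_carrier(1)])
  also have "\<dots> = map_mat emb K * (fr n ?W * den n G Z)"
    by (rule arg_cong[OF fr_act[OF G Z]])
  also have "\<dots> = frame_image n K ?W * den n G Z"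
    unfolding frame_image_def[of n K] by (rule assoc_mult_mat[OF c(1) frame_carrier(1,3), symmetric])
  finally have KG: "frame_image n (K * G) Z = frame_image n K ?W * den n G Z" .
  show "act n K ?W \<in> carrier_mat n n" by (rule act_carrier[OF K W])
  show "det (den n (K * G) Z) \<noteq> 0"
    unfolding KG ev_od_mult(2)[OF f frame_carrier(3)] det_mult[OF frame_carrier(3,3)]
    using det_den[OF G Z] det_den[OF K W] by simp
  show "act n K ?W * den n (K * G) Z = ev n (frame_image n (K * G) Z)"
    unfolding KG ev_od_mult[OF f frame_carrier(3)] act_den[OF K W, symmetric]
    by (rule assoc_mult_mat[symmetric, OF act_carrier[OF K W] frame_carrier(3,3)])
qed

lemma cont_act:
  assumes G: "G \<in> carrier (Sp (R :: 'a itself) n)"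
    and Z: "cont_mat n n Z" "\<And>t. t \<in> {0..1} \<Longrightarrow> uhp n (Z t)"
  shows "cont_mat n n (\<lambda>t. act n G (Z t))"
proof -
  have "cont_mat (2 * n) n (\<lambda>t. fr n (Z t))"
  proof (rule cont_matI)
    fix r j assume "r < 2 * n" "j < n"
    then show "continuous_on {0..1} (\<lambda>t. fr n (Z t) $$ (r, j))"
      using Z(1) by (cases "even r") (auto simp: fr_def cont_mat_def)
  qed simp
  moreover have "cont_mat (2 * n) (2 * n) (\<lambda>t. map_mat emb G)"
    by (rule cont_matI) (use Sp_carrier_mat[OF G] in auto)
  ultimately have F: "cont_mat (2 * n) n (\<lambda>t. frame_image n G (Z t))"
    unfolding frame_image_def by (intro cont_mat_mult)
  have e: "cont_mat n n (\<lambda>t. ev n (frame_image n G (Z t)))" and o: "cont_mat n n (\<lambda>t. den n G (Z t))"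
    by (rule cont_matI; use F in \<open>simp add: ev_def od_def cont_mat_def\<close>)+
  have "cont_mat n n (\<lambda>t. minv (den n G (Z t)))"
  proof (rule cont_matI)
    fix t :: real assume "t \<in> {0..1}"
    then show "minv (den n G (Z t)) \<in> carrier_mat n n"
      using minv(1)[OF frame_carrier(3) det_den[OF G Z(2)]] by simp
  next
    fix i j assume ij: "i < n" "j < n"
    have "continuous_on {0..1} (\<lambda>t. inverse (det (den n G (Z t))) * adj_mat (den n G (Z t)) $$ (i, j))"
      using cont_adj[OF o] ij det_den[OF G Z(2)]
      by (intro continuous_intros cont_det[OF o]) (auto simp: cont_mat_def)
    moreover have "minv (den n G (Z t)) $$ (i, j) = inverse (det (den n G (Z t))) * adj_mat (den n G (Z t)) $$ (i, j)" for t
      using ij adj_mat(1)[OF frame_carrier(3), of n "frame_image n G (Z t)"] by (simp add: minv_def)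
    ultimately show "continuous_on {0..1} (\<lambda>t. minv (den n G (Z t)) $$ (i, j))" by simp
  qed
  then show ?thesis unfolding act_def by (rule cont_mat_mult[OF e])
qed

text \<open>The difference of the two sides is a multiple of \<open>2 \<pi>\<close>, and it stays constant while the
  three points are moved to a single point along segments.\<close>

lemma triple_act:
  assumes G: "G \<in> carrier (Sp (R :: 'a itself) n)" and Z: "uhp n Z0" "uhp n Z1" "uhp n Z2"
  shows "triple n (act n G Z0) (act n G Z1) (act n G Z2) = triple n Z0 Z1 Z2"
proof -
  define A B where "A = segment_mat n Z1 Z0" and "B = segment_mat n Z2 Z0"
  define f where "f = (\<lambda>t. (triple n Z0 (A t) (B t)
      - triple n (act n G Z0) (act n G (A t)) (act n G (B t))) / (2 * pi))"
  have AB: "uhp n (A t)" "uhp n (B t)" if "t \<in> {0..1}" for t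
    using that Z by (auto simp: A_def B_def intro: uhp_segment)
  have c: "cont_mat n n (\<lambda>t. Z0)" "cont_mat n n A" "cont_mat n n B"
    using uhp_carrier[OF Z(1)] unfolding A_def B_def by (auto intro: cont_segment cont_matI)
  note ca = cont_act[OF G c(1) Z(1)] cont_act[OF G c(2) AB(1)] cont_act[OF G c(3) AB(2)]
  have "continuous_on {0..1} f"
    unfolding f_def triple_def
    by (intro continuous_intros cont_kappa c ca) (auto intro!: uhp_act[OF G] Z AB)
  moreover have "f t \<in> \<int>" if t: "t \<in> {0..1}" for t
  proof -
    note u = Z(1) AB(1)[OF t] AB(2)[OF t]
    note d = det_den[OF G u(1)] det_den[OF G u(2)] det_den[OF G u(3)]
    note p = det_pairm_act[OF G u(1) u(2)] det_pairm_act[OF G u(2) u(3)] det_pairm_act[OF G u(1) u(3)]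
    obtain m :: int where "triple n Z0 (A t) (B t)
        - triple n (act n G Z0) (act n G (A t)) (act n G (B t)) = of_int m * (2 * pi)"
      using triple_diff_int[OF u uhp_act[OF G u(1)] uhp_act[OF G u(2)] uhp_act[OF G u(3)] d p] by auto
    then show ?thesis by (simp add: f_def)
  qed
  ultimately have "f 0 = f 1" by (rule int_valued_endpoints)
  moreover have "A 0 = Z1" "B 0 = Z2" "A 1 = Z0" "B 1 = Z0"
    using Z[THEN uhp_carrier] by (auto simp: A_def B_def segment_mat_def intro!: eq_matI)
  \<comment> \<open>All three points agree at 1, so both triples vanish there by
    \<open>kappa_same\<close>, and \<open>f 0 = 0\<close> is the claim.\<close>
  ultimately show ?thesis by (simp add: f_def triple_def kappa_same)
qed

end


section \<open>The Maslov cocycle\<close>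

definition scalar_point :: "nat \<Rightarrow> complex \<Rightarrow> complex mat" where
  "scalar_point n z = mat n n (\<lambda>(i, j). if i = j then z else 0)"

lemma scalar_point_carrier [simp]: "scalar_point n z \<in> carrier_mat n n"
  by (simp add: scalar_point_def)

lemma uhp_scalar_point:
  assumes "Im z > 0"
  shows "uhp n (scalar_point n z)"
  unfolding uhp_iff
proof (intro conjI allI impI scalar_point_carrier)
  fix x :: "nat \<Rightarrow> complex" assume x: "\<exists>i<n. x i \<noteq> 0"
  have "bil n (scalar_point n z) x x = (\<Sum>i<n. z * complex_of_real ((cmod (x i))\<^sup>2))"
    unfolding bil_def
  proof (rule sum.cong[OF refl])
    fix i assume i: "i \<in> {..<n}"
    have "(\<Sum>j<n. cnj (x i) * scalar_point n z $$ (i, j) * x j) = (\<Sum>j<n. if j = i then cnj (x i) * z * x j else 0)"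
      by (rule sum.cong) (use i in \<open>auto simp: scalar_point_def\<close>)
    then show "(\<Sum>j<n. cnj (x i) * scalar_point n z $$ (i, j) * x j) = z * complex_of_real ((cmod (x i))\<^sup>2)"
      using i by (simp add: complex_norm_square mult_ac del: of_real_power)
  qed
  then have "Im (bil n (scalar_point n z) x x) = Im z * (\<Sum>i<n. (cmod (x i))\<^sup>2)"
    by (simp add: sum_distrib_left del: of_real_power)
  moreover have "(\<Sum>i<n. (cmod (x i))\<^sup>2) > 0"
    using x by (auto intro: sum_pos2)
  ultimately show "Im (bil n (scalar_point n z) x x) > 0" using assms by simp
qed

lemma scalar_point_mult: "scalar_point n z * scalar_point n w = scalar_point n (z * w)"
proof (rule eq_matI)
  fix i j assume "i < dim_row (scalar_point n (z * w))" "j < dim_col (scalar_point n (z * w))"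
  then have ij: "i < n" "j < n" by (simp_all add: scalar_point_def)
  have "(scalar_point n z * scalar_point n w) $$ (i, j) = (\<Sum>l<n. if l = i then z * scalar_point n w $$ (l, j) else 0)"
    unfolding index_mult[OF scalar_point_carrier scalar_point_carrier ij]
    by (rule sum.cong) (use ij in \<open>auto simp: scalar_point_def\<close>)
  then show "(scalar_point n z * scalar_point n w) $$ (i, j) = scalar_point n (z * w) $$ (i, j)"
    using ij by (simp add: scalar_point_def)
qed (simp_all add: scalar_point_def)

lemma det_scalar_point: "det (scalar_point n z) = z ^ n"
proof -
  have "scalar_point n z = z \<cdot>\<^sub>m 1\<^sub>m n" by (rule eq_matI) (auto simp: scalar_point_def)
  then show ?thesis by simp
qed

text \<open>Leading blocks are scalar too, so each pivot is a positive multiple of one and the same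
  number. This is the source of the growth in \<open>n\<close>.\<close>

lemma kappa_scalar_point:
  assumes "Im z > 0" "Im w > 0"
  shows "kappa n (scalar_point n z) (scalar_point n w) = real n * ang (\<i> * (cnj z - w))"
proof -
  let ?m = "\<i> * (cnj z - w)"
  have m: "?m \<noteq> 0" using assms by (auto simp: complex_eq_iff)
  have "pivot (pairm n (scalar_point n z) (scalar_point n w)) k = complex_of_real ((cmod (?m ^ k))\<^sup>2) * ?m"
    if "k < n" for k
  proof -
    have "lead k (pairm n (scalar_point n z) (scalar_point n w)) = scalar_point k ?m" if "k \<le> n" for k
      by (rule eq_matI) (use that in \<open>auto simp: lead_def pairm_def scalar_point_def\<close>)
    then have "pivot (pairm n (scalar_point n z) (scalar_point n w)) k = ?m ^ Suc k * cnj (?m ^ k)"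
      using that by (simp only: pivot_def det_scalar_point Suc_leI less_imp_le)
    also have "\<dots> = (?m ^ k * cnj (?m ^ k)) * ?m" by (simp only: power_Suc mult_ac)
    finally show ?thesis by (simp only: complex_norm_square)
  qed
  then have "kappa n (scalar_point n z) (scalar_point n w) = (\<Sum>k<n. ang ?m)"
    unfolding kappa_def arg_det_def using m
    by (intro sum.cong refl) (simp add: ang_of_real_mult del: of_real_power)
  then show ?thesis by simp
qed

section \<open>Block sums and compatibility with stabilization\<close>

definition block_sum :: "complex mat \<Rightarrow> complex mat \<Rightarrow> complex mat" where
  "block_sum A D = four_block_mat A (0\<^sub>m (dim_row A) (dim_col D)) (0\<^sub>m (dim_row D) (dim_col A)) D"

lemma block_sum_mult:
  assumes "A \<in> carrier_mat m k" "D \<in> carrier_mat m' k'" "B \<in> carrier_mat k n" "E \<in> carrier_mat k' n'"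
  shows "block_sum A D * block_sum B E = block_sum (A * B) (D * E)"
  unfolding block_sum_def
  by (subst mult_four_block_mat[of _ m k _ k' _ m' _ _ n _ n'])
    (use assms in \<open>auto simp: mult_carrier_mat[of _ m k _ n] mult_carrier_mat[of _ m' k' _ n']\<close>)

lemma ev_od_block_sum:
  assumes "F \<in> carrier_mat (2 * n) n" "E \<in> carrier_mat 2 1"
  shows "ev (Suc n) (block_sum F E) = block_sum (ev n F) (ev 1 E)"
    and "od (Suc n) (block_sum F E) = block_sum (od n F) (od 1 E)"
  by (rule eq_matI; use assms in \<open>auto simp: ev_def od_def block_sum_def less_Suc_eq\<close>)+

lemma fr_scalar_point_Suc:
  "fr (Suc n) (scalar_point (Suc n) z) = block_sum (fr n (scalar_point n z)) (fr 1 (scalar_point 1 z))"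
  by (rule eq_matI) (auto simp: fr_def scalar_point_def block_sum_def)

text \<open>The new coordinate contributes the entry i (-i - i) = 2, so the last pivot is real and
  adds no argument. The earlier leading blocks are unchanged.\<close>

lemma kappa_block_sum:
  assumes "Z \<in> carrier_mat n n" "W \<in> carrier_mat n n"
  shows "kappa (Suc n) (block_sum Z (scalar_point 1 \<i>)) (block_sum W (scalar_point 1 \<i>)) = kappa n Z W"
proof -
  let ?M = "pairm n Z W" and ?N = "pairm (Suc n) (block_sum Z (scalar_point 1 \<i>)) (block_sum W (scalar_point 1 \<i>))"
  have N: "?N = block_sum ?M (scalar_point 1 2)"
    by (rule eq_matI) (use assms in \<open>auto simp: pairm_def block_sum_def scalar_point_def algebra_simps\<close>)
  have l: "lead k ?N = lead k ?M" if "k \<le> n" for k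
    unfolding N by (rule eq_matI) (use that in \<open>auto simp: lead_def block_sum_def pairm_def\<close>)
  have "det (block_sum ?M (scalar_point 1 2)) = det ?M * 2"
    unfolding block_sum_def
    by (subst det_four_block_mat_lower_left_zero[of _ n _ 1]) (auto simp: pairm_def scalar_point_def det_single)
  then have "pivot ?N n = 2 * complex_of_real ((cmod (det ?M))\<^sup>2)"
    unfolding pivot_def lead_self[OF pairm_carrier] l[OF order_refl] N[symmetric]
    by (simp add: complex_norm_square del: of_real_power)
  then have "ang (pivot ?N n) = 0" by (simp add: ang_real del: of_real_power)
  moreover have "(\<Sum>k<n. ang (pivot ?N k)) = (\<Sum>k<n. ang (pivot ?M k))"
    by (intro sum.cong refl) (simp add: pivot_def l[unfolded One_nat_def])
  ultimately show ?thesis by (simp add: kappa_def arg_det_def)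
qed

lemma tuples_3E:
  assumes "xs \<in> tuples G 3"
  obtains x y z where "xs = [x, y, z]" "x \<in> carrier G" "y \<in> carrier G" "z \<in> carrier G"
proof -
  obtain x y z where "xs = [x, y, z]"
    using assms by (auto simp: tuples_def numeral_3_eq_3 length_Suc_conv)
  with assms that show ?thesis by (auto simp: tuples_def)
qed

lemma coboundary_1:
  assumes "x \<in> carrier G" "y \<in> carrier G" "z \<in> carrier G"
  shows "coboundary G 1 f [x, y, z] = f [y, z] - f [x, z] + f [x, y]"
  using assms by (simp add: coboundary_def tuples_def numeral_2_eq_2)

lemma Sp_mult: "G \<otimes>\<^bsub>Sp R n\<^esub> K = G * K"
  by (simp add: Sp_def)

context real_embedding
begin

definition orbit_point :: "nat \<Rightarrow> 'a mat \<Rightarrow> complex mat" where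
  "orbit_point n g = act n g (scalar_point n \<i>)"

lemma uhp_orbit_point: "g \<in> carrier (Sp (R :: 'a itself) n) \<Longrightarrow> uhp n (orbit_point n g)"
  unfolding orbit_point_def by (rule uhp_act) (auto intro: uhp_scalar_point)

lemma orbit_point_mult:
  "k \<in> carrier (Sp (R :: 'a itself) n) \<Longrightarrow> g \<in> carrier (Sp R n) \<Longrightarrow>
    orbit_point n (k * g) = act n k (orbit_point n g)"
  unfolding orbit_point_def by (rule act_act) (auto intro: uhp_scalar_point)

text \<open>The function inside is bounded but, for \<open>n > 0\<close>, not invariant. It is
  therefore no bounded cochain, and its coboundary can represent a nonzero class.\<close>

definition maslov :: "'a itself \<Rightarrow> nat \<Rightarrow> 'a mat list \<Rightarrow> real" where
  "maslov R n = coboundary (Sp R n) 1 (\<lambda>xs. kappa n (orbit_point n (xs ! 0)) (orbit_point n (xs ! 1)))"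

lemma maslov_triple:
  assumes "x \<in> carrier (Sp R n)" "y \<in> carrier (Sp R n)" "z \<in> carrier (Sp R n)"
  shows "maslov R n [x, y, z] = triple n (orbit_point n x) (orbit_point n y) (orbit_point n z)"
  unfolding maslov_def coboundary_1[OF assms] by (simp add: triple_def)

lemma maslov_outside: "xs \<notin> tuples (Sp R n) 3 \<Longrightarrow> maslov R n xs = 0"
  by (simp add: maslov_def coboundary_def numeral_3_eq_3)

lemma maslov_cocycle: "maslov R n \<in> bounded_cocycles (Sp R n) 2"
proof -
  interpret G: group "Sp R n" by (rule group_Sp)
  have "maslov R n (map ((\<otimes>\<^bsub>Sp R n\<^esub>) g) xs) = maslov R n xs"
    if g: "g \<in> carrier (Sp R n)" and xs: "xs \<in> tuples (Sp R n) 3" for g xs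
    using xs
  proof (rule tuples_3E)
    fix x y z assume "xs = [x, y, z]" and c: "x \<in> carrier (Sp R n)" "y \<in> carrier (Sp R n)" "z \<in> carrier (Sp R n)"
    moreover have "maslov R n [g \<otimes>\<^bsub>Sp R n\<^esub> x, g \<otimes>\<^bsub>Sp R n\<^esub> y, g \<otimes>\<^bsub>Sp R n\<^esub> z] = maslov R n [x, y, z]"
      unfolding maslov_triple[OF c] maslov_triple[OF G.m_closed[OF g c(1)] G.m_closed[OF g c(2)] G.m_closed[OF g c(3)]]
      unfolding Sp_mult orbit_point_mult[OF g c(1)] orbit_point_mult[OF g c(2)] orbit_point_mult[OF g c(3)]
      by (rule triple_act[OF g uhp_orbit_point[OF c(1)] uhp_orbit_point[OF c(2)] uhp_orbit_point[OF c(3)]])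
    ultimately show ?thesis by simp
  qed
  moreover have "\<bar>maslov R n xs\<bar> \<le> 3 * (real n * (pi / 2))" if "xs \<in> tuples (Sp R n) 3" for xs
    using that by (rule tuples_3E) (simp only: maslov_triple triple_bound)
  then have "\<exists>C. \<forall>xs\<in>tuples (Sp R n) 3. \<bar>maslov R n xs\<bar> \<le> C" by blast
  ultimately have "maslov R n \<in> bounded_cochains (Sp R n) 2"
    unfolding bounded_cochains_def using maslov_outside[of _ R n] by (simp add: numeral_3_eq_3 numeral_2_eq_2)
  \<comment> \<open>The square of the coboundary vanishes on arbitrary functions, invariant or
    not.\<close>
  moreover have "coboundary (Sp R n) (Suc 1) (maslov R n) = (\<lambda>_. 0)"
    unfolding maslov_def by (rule coboundary_coboundary)
  ultimately show ?thesis by (simp add: bounded_cocycles_def numeral_2_eq_2)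
qed

text \<open>The base point of size \<open>Suc n\<close> splits as a block sum, and the stabilized
  matrix is the identity on the second summand.\<close>

lemma orbit_point_stab:
  assumes g: "g \<in> carrier (Sp (R :: 'a itself) n)"
  shows "orbit_point (Suc n) (Sp_stab n g) = block_sum (orbit_point n g) (scalar_point 1 \<i>)"
  unfolding orbit_point_def
proof (rule act_eqI)
  let ?p = "scalar_point n \<i>" and ?F = "frame_image n g (scalar_point n \<i>)" and ?E = "fr 1 (scalar_point 1 \<i>)"
  note p = uhp_scalar_point[of \<i> n, simplified]
  have gc: "g \<in> carrier_mat (2 * n) (2 * n)" using g by (rule Sp_carrier_mat)
  then have F: "?F \<in> carrier_mat (2 * n) n" by (rule frame_image_carrier)
  have E: "?E \<in> carrier_mat 2 1" using frame_carrier(1)[of 1] by simp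
  have m: "map_mat emb (Sp_stab n g) = block_sum (map_mat emb g) (1\<^sub>m 2)"
    unfolding Sp_stab_def block_sum_def
    by (rule eq_matI) (use gc in \<open>auto\<close>)
  have "frame_image (Suc n) (Sp_stab n g) (scalar_point (Suc n) \<i>)
      = block_sum (map_mat emb g * fr n ?p) (1\<^sub>m 2 * ?E)"
    unfolding frame_image_def m fr_scalar_point_Suc
    by (rule block_sum_mult[of _ "2 * n" "2 * n" _ 2 2 _ n _ 1]) (use gc E in auto)
  then have FE: "frame_image (Suc n) (Sp_stab n g) (scalar_point (Suc n) \<i>) = block_sum ?F ?E"
    using E by (simp add: frame_image_def)
  show "det (den (Suc n) (Sp_stab n g) (scalar_point (Suc n) \<i>)) \<noteq> 0"
    by (rule det_den[OF hom_in_carrier[OF Sp_stab_hom g]]) (simp add: uhp_scalar_point)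
  note a = act_carrier[OF g p]
  show "block_sum (act n g ?p) (scalar_point 1 \<i>) \<in> carrier_mat (Suc n) (Suc n)"
    using four_block_carrier_mat[OF a scalar_point_carrier[of 1]] by (simp add: block_sum_def)
  show "block_sum (act n g ?p) (scalar_point 1 \<i>) * den (Suc n) (Sp_stab n g) (scalar_point (Suc n) \<i>)
    = ev (Suc n) (frame_image (Suc n) (Sp_stab n g) (scalar_point (Suc n) \<i>))"
    unfolding FE ev_od_block_sum[OF F E] block_sum_mult[OF a scalar_point_carrier frame_carrier(3) frame_carrier(3)]
    unfolding act_den[OF g p] ev_od_fr(1)[OF scalar_point_carrier] ev_od_fr(2)
    by (simp add: right_mult_one_mat[OF scalar_point_carrier])
qed

text \<open>An identity of cochains, not only of classes; it makes the Maslov classes a compatible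
  family.\<close>

lemma maslov_stab: "cochain_pullback (Sp R n) (Sp_stab n) 2 (maslov R (Suc n)) = maslov R n"
proof
  fix xs
  show "cochain_pullback (Sp R n) (Sp_stab n) 2 (maslov R (Suc n)) xs = maslov R n xs"
  proof (cases "xs \<in> tuples (Sp R n) 3")
    case True
    then show ?thesis
    proof (rule tuples_3E)
      fix x y z assume xs: "xs = [x, y, z]"
        and c: "x \<in> carrier (Sp R n)" "y \<in> carrier (Sp R n)" "z \<in> carrier (Sp R n)"
      note s = hom_in_carrier[OF Sp_stab_hom c(1)] hom_in_carrier[OF Sp_stab_hom c(2)] hom_in_carrier[OF Sp_stab_hom c(3)]
      note u = c[THEN uhp_orbit_point, THEN uhp_carrier]
      have "maslov R (Suc n) [Sp_stab n x, Sp_stab n y, Sp_stab n z] = maslov R n [x, y, z]"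
        unfolding maslov_triple[OF c] maslov_triple[OF s] triple_def
        by (simp only: orbit_point_stab[OF c(1)] orbit_point_stab[OF c(2)] orbit_point_stab[OF c(3)]
            kappa_block_sum u)
      then show ?thesis using True xs by (simp add: cochain_pullback_def)
    qed
  next
    case False
    then show ?thesis by (simp add: cochain_pullback_def maslov_outside)
  qed
qed

lemma maslov_class_in_limit:
  "(\<lambda>h. bounded_class (Sp R h) 2 (maslov R h)) \<in> carrier (Sp_stable_bounded_cohomology R 2)"
  unfolding Sp_stable_bounded_cohomology_def sequential_limit_def
  by (simp add: carrier_bounded_cohomology maslov_cocycle maslov_stab
      bounded_cohomology_map_class[OF group_Sp Sp_stab_hom])

end


section \<open>Norms of classes in degree two\<close>

text \<open>In inhomogeneous notation the summand is q(x^j, x). For a coboundary the sum telescopes,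
  see \<open>power_sum_coboundary\<close>.\<close>

definition power_sum :: "('a, 'm) monoid_scheme \<Rightarrow> ('a list \<Rightarrow> real) \<Rightarrow> 'a \<Rightarrow> nat \<Rightarrow> real" where
  "power_sum G q x N = (\<Sum>j<N. q [\<one>\<^bsub>G\<^esub>, x [^]\<^bsub>G\<^esub> j, x [^]\<^bsub>G\<^esub> Suc j])"

text \<open>If \<open>q\<close> is the coboundary of a quasimorphism \<open>\<phi>\<close>, then this is \<open>N\<close> times the value at
  \<open>(s, u)\<close> of the coboundary of the homogenisation of \<open>\<phi>\<close>, up to an error that is bounded
  independently of \<open>N\<close>.\<close>

definition homogeneous_defect :: "('a, 'm) monoid_scheme \<Rightarrow> ('a list \<Rightarrow> real) \<Rightarrow> 'a \<Rightarrow> 'a \<Rightarrow> nat \<Rightarrow> real" where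
  "homogeneous_defect G q s u N = real N * q [\<one>\<^bsub>G\<^esub>, s, s \<otimes>\<^bsub>G\<^esub> u]
     - power_sum G q u N - power_sum G q s N + power_sum G q (s \<otimes>\<^bsub>G\<^esub> u) N"

lemma homogeneous_defect_add:
  "homogeneous_defect G (\<lambda>xs. p xs + q xs) s u N = homogeneous_defect G p s u N + homogeneous_defect G q s u N"
  by (simp add: homogeneous_defect_def power_sum_def sum.distrib algebra_simps)

context group
begin

lemma power_sum_bound:
  assumes "\<And>xs. xs \<in> tuples G 3 \<Longrightarrow> \<bar>q xs\<bar> \<le> C" "x \<in> carrier G"
  shows "\<bar>power_sum G q x N\<bar> \<le> real N * C"
proof -
  have "\<bar>power_sum G q x N\<bar> \<le> (\<Sum>j<N. \<bar>q [\<one>, x [^] j, x [^] Suc j]\<bar>)"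
    unfolding power_sum_def by (rule sum_abs)
  also have "\<dots> \<le> (\<Sum>j<N. C)"
    by (rule sum_mono, rule assms(1)) (use assms(2) in \<open>simp add: tuples_def\<close>)
  finally show ?thesis by simp
qed

lemma homogeneous_defect_bound:
  assumes q: "\<And>xs. xs \<in> tuples G 3 \<Longrightarrow> \<bar>q xs\<bar> \<le> C" and su: "s \<in> carrier G" "u \<in> carrier G"
  shows "\<bar>homogeneous_defect G q s u N\<bar> \<le> 4 * (real N * C)"
proof -
  have "\<bar>q [\<one>, s, s \<otimes> u]\<bar> \<le> C" using su by (intro q) (simp add: tuples_def)
  then have "\<bar>real N * q [\<one>, s, s \<otimes> u]\<bar> \<le> real N * C"
    by (simp add: abs_mult mult_left_mono)
  moreover have "\<bar>power_sum G q u N\<bar> \<le> real N * C" "\<bar>power_sum G q s N\<bar> \<le> real N * C"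
    "\<bar>power_sum G q (s \<otimes> u) N\<bar> \<le> real N * C"
    using su by (intro power_sum_bound q; simp)+
  ultimately show ?thesis unfolding homogeneous_defect_def by linarith
qed

lemma bounded_cochain_1_invariant:
  assumes "b \<in> bounded_cochains G 1" "x \<in> carrier G" "y \<in> carrier G"
  shows "b [x, x \<otimes> y] = b [\<one>, y]"
  using bounded_cochains_invariant[OF assms(1,2), of "[\<one>, y]"] assms(2,3)
  by (simp add: tuples_def)

lemma power_sum_coboundary:
  assumes b: "b \<in> bounded_cochains G 1" and x: "x \<in> carrier G"
  shows "power_sum G (coboundary G 1 b) x N = real N * b [\<one>, x] - b [\<one>, x [^] N] + b [\<one>, \<one>]"
proof -
  have "power_sum G (coboundary G 1 b) x N =
      (\<Sum>j<N. b [\<one>, x] - (b [\<one>, x [^] Suc j] - b [\<one>, x [^] j]))"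
    unfolding power_sum_def
  proof (rule sum.cong[OF refl])
    fix j
    have "b [x [^] j, x [^] Suc j] = b [\<one>, x]"
      using bounded_cochain_1_invariant[OF b, of "x [^] j" x] x by simp
    then show "coboundary G 1 b [\<one>, x [^] j, x [^] Suc j] = b [\<one>, x] - (b [\<one>, x [^] Suc j] - b [\<one>, x [^] j])"
      using coboundary_1[of \<one> G "x [^] j" "x [^] Suc j" b] x by simp
  qed
  also have "\<dots> = real N * b [\<one>, x] - (b [\<one>, x [^] N] - b [\<one>, x [^] (0::nat)])"
    unfolding sum_subtractf[of "\<lambda>_. b [\<one>, x]"] sum_lessThan_telescope[of "\<lambda>j. b [\<one>, x [^] j]"] by simp
  finally show ?thesis by simp
qed

text \<open>The terms linear in \<open>N\<close> cancel between the three power sums and the first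
  summand. Four values of \<open>b\<close> remain, so \<open>6 * B\<close> is a generous
  bound.\<close>

lemma homogeneous_defect_coboundary:
  assumes b: "b \<in> bounded_cochains G 1" and su: "s \<in> carrier G" "u \<in> carrier G"
  shows "\<exists>B. \<forall>N. \<bar>homogeneous_defect G (coboundary G 1 b) s u N\<bar> \<le> B"
proof -
  obtain B where B: "\<forall>xs\<in>tuples G 2. \<bar>b xs\<bar> \<le> B"
    using b by (auto simp: bounded_cochains_def numeral_2_eq_2)
  have b1: "\<bar>b [\<one>, x]\<bar> \<le> B" if "x \<in> carrier G" for x
    using B that by (simp add: tuples_def)
  have "\<bar>homogeneous_defect G (coboundary G 1 b) s u N\<bar> \<le> 6 * B" for N
  proof -
    have e: "coboundary G 1 b [\<one>, s, s \<otimes> u] = b [\<one>, u] - b [\<one>, s \<otimes> u] + b [\<one>, s]"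
      using coboundary_1[of \<one> G s "s \<otimes> u" b] bounded_cochain_1_invariant[OF b su] su by simp
    have "homogeneous_defect G (coboundary G 1 b) s u N =
        b [\<one>, u [^] N] + b [\<one>, s [^] N] - b [\<one>, (s \<otimes> u) [^] N] - b [\<one>, \<one>]"
      unfolding homogeneous_defect_def power_sum_coboundary[OF b su(1)] power_sum_coboundary[OF b su(2)]
        power_sum_coboundary[OF b m_closed[OF su]] e
      by (simp add: algebra_simps)
    moreover have "\<bar>b [\<one>, u [^] N]\<bar> \<le> B" "\<bar>b [\<one>, s [^] N]\<bar> \<le> B" "\<bar>b [\<one>, (s \<otimes> u) [^] N]\<bar> \<le> B"
      "\<bar>b [\<one>, \<one>]\<bar> \<le> B"
      using su by (intro b1; simp)+
    ultimately show ?thesis by linarith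
  qed
  then show ?thesis by blast
qed

end


section \<open>Diagonally embedded elements of the special linear group\<close>

definition diag_sl :: "nat \<Rightarrow> 'a \<Rightarrow> 'a \<Rightarrow> 'a \<Rightarrow> 'a \<Rightarrow> 'a :: comm_ring_1 mat" where
  "diag_sl n a b c d = mat (2 * n) (2 * n) (\<lambda>(i, j). if i div 2 \<noteq> j div 2 then 0
     else if even i then (if even j then a else b) else (if even j then c else d))"

lemma diag_sl_carrier [simp]: "diag_sl n a b c d \<in> carrier_mat (2 * n) (2 * n)"
  by (simp add: diag_sl_def)

lemma sum_diag_sl:
  assumes "l < n"
  shows "(\<Sum>k<2 * n. diag_sl n a b c d $$ (2 * l, k) * f k) = a * f (2 * l) + b * f (Suc (2 * l))"
    and "(\<Sum>k<2 * n. diag_sl n a b c d $$ (Suc (2 * l), k) * f k) = c * f (2 * l) + d * f (Suc (2 * l))"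
proof -
  have sub: "{2 * l, Suc (2 * l)} \<subseteq> {..<2 * n}" using assms by auto
  have z: "diag_sl n a b c d $$ (r, k) = 0" if "r < 2 * n" "k < 2 * n" "r div 2 \<noteq> k div 2" for r k
    using that by (simp add: diag_sl_def)
  have "(\<Sum>k<2 * n. diag_sl n a b c d $$ (r, k) * f k) = (\<Sum>k\<in>{2 * l, Suc (2 * l)}. diag_sl n a b c d $$ (r, k) * f k)"
    if "r < 2 * n" "r div 2 = l" for r
  proof (rule sum.mono_neutral_right)
    show "\<forall>k\<in>{..<2 * n} - {2 * l, Suc (2 * l)}. diag_sl n a b c d $$ (r, k) * f k = 0"
    proof
      fix k assume k: "k \<in> {..<2 * n} - {2 * l, Suc (2 * l)}"
      have "k div 2 \<noteq> l" using k by (cases "even k") (auto elim!: evenE oddE)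
      then show "diag_sl n a b c d $$ (r, k) * f k = 0" using z[of r k] k that by auto
    qed
  qed (use sub in auto)
  then show "(\<Sum>k<2 * n. diag_sl n a b c d $$ (2 * l, k) * f k) = a * f (2 * l) + b * f (Suc (2 * l))"
    "(\<Sum>k<2 * n. diag_sl n a b c d $$ (Suc (2 * l), k) * f k) = c * f (2 * l) + d * f (Suc (2 * l))"
    using assms by (simp_all add: diag_sl_def)
qed

lemma diag_sl_mult:
  "diag_sl n a b c d * diag_sl n a' b' c' d'
    = diag_sl n (a * a' + b * c') (a * b' + b * d') (c * a' + d * c') (c * b' + d * d')"
proof (rule eq_matI)
  fix i j
  assume "i < dim_row (diag_sl n (a * a' + b * c') (a * b' + b * d') (c * a' + d * c') (c * b' + d * d'))"
    and "j < dim_col (diag_sl n (a * a' + b * c') (a * b' + b * d') (c * a' + d * c') (c * b' + d * d'))"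
  then have ij: "i < 2 * n" "j < 2 * n" by (simp_all add: diag_sl_def)
  define l where "l = i div 2"
  have l: "l < n" using ij by (simp add: l_def)
  have "i = 2 * l \<or> i = Suc (2 * l)" unfolding l_def by presburger
  then show "(diag_sl n a b c d * diag_sl n a' b' c' d') $$ (i, j) =
     diag_sl n (a * a' + b * c') (a * b' + b * d') (c * a' + d * c') (c * b' + d * d') $$ (i, j)"
  proof (elim disjE)
    assume i: "i = 2 * l"
    show ?thesis unfolding index_mult[OF diag_sl_carrier diag_sl_carrier ij] unfolding i sum_diag_sl(1)[OF l] using ij l by (auto simp: diag_sl_def)
  next
    assume i: "i = Suc (2 * l)"
    show ?thesis unfolding index_mult[OF diag_sl_carrier diag_sl_carrier ij] unfolding i sum_diag_sl(2)[OF l] using ij l by (auto simp: diag_sl_def)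
  qed
qed (simp_all add: diag_sl_def)

lemma diag_sl_one: "diag_sl n 1 0 0 1 = 1\<^sub>m (2 * n)"
proof (rule eq_matI)
  fix i j assume "i < dim_row (1\<^sub>m (2 * n) :: 'a mat)" "j < dim_col (1\<^sub>m (2 * n) :: 'a mat)"
  moreover have "i div 2 = j div 2 \<Longrightarrow> (even i \<longleftrightarrow> even j) \<longleftrightarrow> i = j" by presburger
  ultimately show "diag_sl n 1 0 0 1 $$ (i, j) = (1\<^sub>m (2 * n) :: 'a mat) $$ (i, j)"
    by (auto simp: diag_sl_def)
qed (simp_all add: diag_sl_def)

text \<open>The inverse is the adjugate in each block, and each coordinate plane contributes its
  area form scaled by \<open>a * d - b * c\<close>.\<close>

lemma diag_sl_Sp:
  assumes "a * d - b * c = 1"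
  shows "diag_sl n a b c d \<in> carrier (Sp R n)"
proof -
  let ?A = "diag_sl n a b c d" and ?B = "diag_sl n d (- b) (- c) a"
  have "a * d + b * - c = 1" "a * - b + b * a = 0" "c * d + d * - c = 0" "c * - b + d * a = 1"
    "d * a + - b * c = 1" "d * b + - b * d = 0" "- c * a + a * c = 0" "- c * b + a * d = 1"
    using assms by (simp_all add: algebra_simps)
  then have "?A * ?B = 1\<^sub>m (2 * n)" "?B * ?A = 1\<^sub>m (2 * n)"
    by (simp_all only: diag_sl_mult diag_sl_one)
  then have "invertible_mat ?A"
    unfolding invertible_mat_def inverts_mat_def by (auto intro!: exI[of _ ?B] simp: diag_sl_def)
  moreover have mv: "(?A *\<^sub>v x) $ r = (\<Sum>k<2 * n. ?A $$ (r, k) * x $ k)"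
    if "x \<in> carrier_vec (2 * n)" "r < 2 * n" for x r
    using that carrier_matD[OF diag_sl_carrier[of n a b c d]]
    by (simp add: scalar_prod_def atLeast0LessThan)
  have "symplectic_form n (?A *\<^sub>v v) (?A *\<^sub>v w) = symplectic_form n v w"
    if v: "v \<in> carrier_vec (2 * n)" and w: "w \<in> carrier_vec (2 * n)" for v w
    unfolding symplectic_form_def
  proof (rule sum.cong[OF refl])
    fix l assume "l \<in> {..<n}"
    then have l: "l < n" by simp
    have r: "(?A *\<^sub>v x) $ (2 * l) = a * x $ (2 * l) + b * x $ Suc (2 * l)"
      "(?A *\<^sub>v x) $ (2 * l + 1) = c * x $ (2 * l) + d * x $ Suc (2 * l)" if "x \<in> carrier_vec (2 * n)" for x
      using mv[OF that, of "2 * l"] mv[OF that, of "Suc (2 * l)"] l by (simp_all add: sum_diag_sl[OF l])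
    have "(?A *\<^sub>v v) $ (2 * l) * (?A *\<^sub>v w) $ (2 * l + 1) - (?A *\<^sub>v v) $ (2 * l + 1) * (?A *\<^sub>v w) $ (2 * l)
      = (a * d - b * c) * (v $ (2 * l) * w $ (2 * l + 1) - v $ (2 * l + 1) * w $ (2 * l))"
      unfolding r[OF v] r[OF w] by (simp add: algebra_simps)
    then show "(?A *\<^sub>v v) $ (2 * l) * (?A *\<^sub>v w) $ (2 * l + 1) - (?A *\<^sub>v v) $ (2 * l + 1) * (?A *\<^sub>v w) $ (2 * l)
      = v $ (2 * l) * w $ (2 * l + 1) - v $ (2 * l + 1) * w $ (2 * l)"
      unfolding assms by simp
  qed
  ultimately show ?thesis by (simp add: Sp_def)
qed

context real_embedding
begin

text \<open>On scalar points the diagonal subgroup acts by ordinary Moebius maps; the condition on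
  \<open>w\<close> is the Moebius formula cleared of its denominator.\<close>

lemma act_diag_sl:
  assumes det: "a * d - b * c = 1" and z: "Im z > 0"
    and w: "w * (emb c * z + emb d) = emb a * z + emb b"
  shows "act n (diag_sl n a b c d) (scalar_point n z) = scalar_point n w"
proof (rule act_eqI)
  let ?A = "diag_sl n a b c d" and ?F = "frame_image n (diag_sl n a b c d) (scalar_point n z)"
  have m: "map_mat emb ?A = diag_sl n (emb a) (emb b) (emb c) (emb d)"
    by (rule eq_matI) (auto simp: diag_sl_def)
  have i: "?F $$ (r, j) = (\<Sum>k<2 * n. diag_sl n (emb a) (emb b) (emb c) (emb d) $$ (r, k) * fr n (scalar_point n z) $$ (k, j))"
    if "r < 2 * n" "j < n" for r j
    unfolding frame_image_def m using that by (rule index_mult[OF diag_sl_carrier frame_carrier(1)])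
  have f: "fr n (scalar_point n z) $$ (2 * l, j) = (if l = j then z else 0)"
    "fr n (scalar_point n z) $$ (Suc (2 * l), j) = (if l = j then 1 else 0)" if "l < n" "j < n" for l j
    using that by (auto simp: fr_def scalar_point_def)
  have F: "?F $$ (2 * l, j) = scalar_point n (emb a * z + emb b) $$ (l, j)"
    "?F $$ (2 * l + 1, j) = scalar_point n (emb c * z + emb d) $$ (l, j)" if "l < n" "j < n" for l j
    using that by (simp_all add: i sum_diag_sl f) (simp_all add: scalar_point_def)
  have d: "dim_row (scalar_point n y) = n" "dim_col (scalar_point n y) = n" for y
    by (simp_all add: scalar_point_def)
  have ev: "ev n ?F = scalar_point n (emb a * z + emb b)"
    by (rule eq_matI) (simp_all add: ev_def F d)
  have od: "od n ?F = scalar_point n (emb c * z + emb d)"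
    by (rule eq_matI) (simp_all add: od_def F[simplified] d)
  show "scalar_point n w * den n ?A (scalar_point n z) = ev n ?F"
    unfolding ev od scalar_point_mult w ..
  show "det (den n ?A (scalar_point n z)) \<noteq> 0"
    by (rule det_den[OF diag_sl_Sp[OF det]]) (rule uhp_scalar_point[OF z])
qed simp

lemma orbit_point_one: "orbit_point n (1\<^sub>m (2 * n)) = scalar_point n \<i>"
  unfolding orbit_point_def diag_sl_one[symmetric] by (rule act_diag_sl) simp_all

text \<open>The terms based at the identity telescope, leaving the arguments along consecutive orbit
  points and one boundary term.\<close>

lemma power_sum_maslov:
  assumes x: "x \<in> carrier (Sp R n)"
    and z: "\<And>j. orbit_point n (x [^]\<^bsub>Sp R n\<^esub> j) = scalar_point n (z j)" "\<And>j. Im (z j) > 0"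
  shows "power_sum (Sp R n) (maslov R n) x N =
    real n * ((\<Sum>j<N. ang (\<i> * (cnj (z j) - z (Suc j)))) - ang (\<i> * (cnj (z 0) - z N)))"
proof -
  interpret G: group "Sp R n" by (rule group_Sp)
  define k where "k = (\<lambda>i j. ang (\<i> * (cnj (z i) - z j)))"
  have k: "kappa n (scalar_point n (z i)) (scalar_point n (z j)) = real n * k i j" for i j
    unfolding k_def by (rule kappa_scalar_point) (rule z)+
  have one: "orbit_point n \<one>\<^bsub>Sp R n\<^esub> = scalar_point n (z 0)"
    using z(1)[of 0] by simp
  have "k 0 0 = 0" using z(2) by (simp add: k_def ang_real)
  have "power_sum (Sp R n) (maslov R n) x N = (\<Sum>j<N. real n * (k j (Suc j) - (k 0 (Suc j) - k 0 j)))"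
    unfolding power_sum_def
  proof (rule sum.cong[OF refl])
    fix j
    have "maslov R n [\<one>\<^bsub>Sp R n\<^esub>, x [^]\<^bsub>Sp R n\<^esub> j, x [^]\<^bsub>Sp R n\<^esub> Suc j] =
      triple n (orbit_point n \<one>\<^bsub>Sp R n\<^esub>) (orbit_point n (x [^]\<^bsub>Sp R n\<^esub> j)) (orbit_point n (x [^]\<^bsub>Sp R n\<^esub> Suc j))"
      by (rule maslov_triple) (rule G.one_closed G.nat_pow_closed[OF x])+
    then show "maslov R n [\<one>\<^bsub>Sp R n\<^esub>, x [^]\<^bsub>Sp R n\<^esub> j, x [^]\<^bsub>Sp R n\<^esub> Suc j]
        = real n * (k j (Suc j) - (k 0 (Suc j) - k 0 j))"
      unfolding one z(1) triple_def k by (simp add: algebra_simps)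
  qed
  also have "\<dots> = real n * ((\<Sum>j<N. k j (Suc j)) - (k 0 N - k 0 0))"
    unfolding sum_distrib_left[symmetric] sum_subtractf[of "\<lambda>j. k j (Suc j)"] sum_lessThan_telescope[of "k 0"] ..
  finally show ?thesis using \<open>k 0 0 = 0\<close> by (simp add: k_def)
qed

lemma orbit_point_pow:
  assumes "x \<in> carrier (Sp (R :: 'a itself) n)" "z 0 = \<i>"
    and "\<And>j. act n x (scalar_point n (z j)) = scalar_point n (z (Suc j))"
  shows "orbit_point n (x [^]\<^bsub>Sp R n\<^esub> j) = scalar_point n (z j)"
proof (induction j)
  case 0
  then show ?case using orbit_point_one[of n] assms(2) by (simp add: Sp_def)
next
  case (Suc j)
  interpret G: group "Sp R n" by (rule group_Sp)
  have "x [^]\<^bsub>Sp R n\<^esub> Suc j = x * x [^]\<^bsub>Sp R n\<^esub> j"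
    using G.nat_pow_Suc2[OF assms(1)] by (simp add: Sp_mult)
  then show ?case using Suc orbit_point_mult[OF assms(1) G.nat_pow_closed[OF assms(1)]] assms(3) by simp
qed

text \<open>For \<open>s = (0, -1; 1, 0)\<close> and \<open>u = (0, 1; -1, -1)\<close> one has \<open>s u = (1, 1; 0, 1)\<close>. The orbits of
  \<open>\<i>\<close> are \<open>\<i>\<close> for \<open>s\<close>, a triangle for \<open>u\<close>, and \<open>\<i> + j\<close> for \<open>s u\<close>.\<close>

lemma homogeneous_defect_maslov:
  fixes R :: "'a itself" and n :: nat
  defines "s \<equiv> diag_sl n 0 (-1) 1 0" and "u \<equiv> diag_sl n 0 1 (-1) (-1)"
  shows "s \<in> carrier (Sp R n)" "u \<in> carrier (Sp R n)"
    and "homogeneous_defect (Sp R n) (maslov R n) s u (3 * m)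
      \<le> real n * (pi / 2 - 2 * real m * (arctan (1 / 2) + arctan (1 / 3)))"
proof -
  interpret G: group "Sp R n" by (rule group_Sp)
  show s: "s \<in> carrier (Sp R n)" unfolding s_def by (rule diag_sl_Sp) simp
  show u: "u \<in> carrier (Sp R n)" unfolding u_def by (rule diag_sl_Sp) simp
  define t where "t = s \<otimes>\<^bsub>Sp R n\<^esub> u"
  have t_eq: "t = diag_sl n 1 1 0 1"
    unfolding t_def s_def u_def Sp_mult diag_sl_mult by simp
  have t: "t \<in> carrier (Sp R n)" unfolding t_def using s u by simp
  \<comment> \<open>The orbit of i under z -> -1 / (z + 1), which has period 3. Hence the exponent
    \<open>3 * m\<close>, at which the boundary term vanishes.\<close>
  define p where "p = (\<lambda>j::nat. if j mod 3 = 0 then \<i> else if j mod 3 = 1 then (-1 + \<i>) / 2 else -1 + \<i>)"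
  have ps: "orbit_point n (s [^]\<^bsub>Sp R n\<^esub> j) = scalar_point n \<i>" for j :: nat
    by (rule orbit_point_pow[OF s, where z = "\<lambda>j. \<i>"])
      (simp_all add: s_def act_diag_sl hom_uminus)
  have pt: "orbit_point n (t [^]\<^bsub>Sp R n\<^esub> j) = scalar_point n (\<i> + of_nat j)" for j :: nat
    by (rule orbit_point_pow[OF t]) (simp_all add: t_eq act_diag_sl add_ac)
  have pu: "orbit_point n (u [^]\<^bsub>Sp R n\<^esub> j) = scalar_point n (p j)" for j :: nat
  proof (rule orbit_point_pow[OF u])
    fix j :: nat
    have "p (Suc j) * (- p j - 1) = 1"
      by (auto simp: p_def mod_Suc complex_eq_iff)
    moreover have "Im (p j) > 0" by (simp add: p_def)
    ultimately show "act n u (scalar_point n (p j)) = scalar_point n (p (Suc j))"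
      unfolding u_def by (intro act_diag_sl) (simp_all add: hom_uminus)
  qed (simp add: p_def)
  have "power_sum (Sp R n) (maslov R n) s (3 * m) = 0"
    by (subst power_sum_maslov[OF s ps]) (simp_all add: ang_real)
  moreover have "power_sum (Sp R n) (maslov R n) t (3 * m) \<le> real n * (pi / 2 - 3 * real m * arctan (1 / 2))"
  proof -
    \<comment> \<open>Consecutive points differ by 1, so the number inside is 2 - i at every
      step.\<close>
    have "ang (\<i> * (cnj (\<i> + of_nat j) - (\<i> + of_nat (Suc j)))) = - arctan (1 / 2)" for j
      by (simp add: ang_def arctan_minus[symmetric])
    then have "power_sum (Sp R n) (maslov R n) t (3 * m)
        = real n * (- (3 * real m * arctan (1 / 2)) - ang (\<i> * (cnj (\<i> + of_nat 0) - (\<i> + of_nat (3 * m)))))"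
      by (subst power_sum_maslov[OF t pt]) simp_all
    \<comment> \<open>The boundary term costs at most pi / 2, whatever \<open>m\<close> is.\<close>
    also have "\<dots> \<le> real n * (pi / 2 - 3 * real m * arctan (1 / 2))"
      using ang_bound[of "\<i> * (cnj (\<i> + of_nat 0) - (\<i> + of_nat (3 * m)))"]
      by (intro mult_left_mono) linarith+
    finally show ?thesis .
  qed
  moreover have "power_sum (Sp R n) (maslov R n) u (3 * m) = real n * (real m * (2 * arctan (1 / 3) - arctan (1 / 2)))"
  proof -
    \<comment> \<open>Along the triangle the number is (3 + i) / 2 twice and 2 - i once.\<close>
    have a: "ang (\<i> * (cnj (p j) - p (Suc j))) = (if j mod 3 = 2 then - arctan (1 / 2) else arctan (1 / 3))" for j
      by (auto simp: p_def mod_Suc ang_def arctan_minus[symmetric])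
    have "(\<Sum>j<3 * m. ang (\<i> * (cnj (p j) - p (Suc j)))) = real m * (2 * arctan (1 / 3) - arctan (1 / 2))"
      unfolding a
    proof (induction m)
      case (Suc m)
      have e: "3 * Suc m = Suc (Suc (Suc (3 * m)))" by simp
      have "(\<Sum>j<3 * Suc m. if j mod 3 = 2 then - arctan (1 / 2) else arctan (1 / 3))
        = (\<Sum>j<3 * m. if j mod 3 = 2 then - arctan (1 / 2) else arctan (1 / 3)) + (2 * arctan (1 / 3) - arctan (1 / 2))"
        unfolding e sum.lessThan_Suc by (simp add: mod_Suc)
      then show ?case unfolding Suc by (simp add: algebra_simps)
    qed simp
    then show ?thesis
      by (subst power_sum_maslov[OF u pu]) (simp_all add: p_def ang_real)
  qed
  \<comment> \<open>\<open>s\<close> fixes i, so the first two points agree: one term is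
    \<open>kappa\<close> at equal points and the other two cancel.\<close>
  moreover have "maslov R n [\<one>\<^bsub>Sp R n\<^esub>, s, t] = 0"
    unfolding maslov_triple[OF G.one_closed s t] triple_def
    using ps[of 0] ps[of 1] s by (simp add: kappa_same)
  ultimately show "homogeneous_defect (Sp R n) (maslov R n) s u (3 * m)
      \<le> real n * (pi / 2 - 2 * real m * (arctan (1 / 2) + arctan (1 / 3)))"
    unfolding homogeneous_defect_def t_def[symmetric] by (simp add: algebra_simps)
qed

section \<open>Failure of surjectivity in degree two\<close>

theorem stable_restriction_not_surjective:
  fixes R :: "'a itself"
  shows "\<not> carrier (Sp_stable_bounded_cohomology R 2)
    \<subseteq> Sp_restriction R 2 ` carrier (bounded_cohomology (Sp_infinity R) 2)"
proof
  assume "carrier (Sp_stable_bounded_cohomology R 2)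
    \<subseteq> Sp_restriction R 2 ` carrier (bounded_cohomology (Sp_infinity R) 2)"
  then obtain X where X: "X \<in> carrier (bounded_cohomology (Sp_infinity R) 2)"
    and res: "(\<lambda>h. bounded_class (Sp R h) 2 (maslov R h)) = Sp_restriction R 2 X"
    using maslov_class_in_limit[of R] by blast
  obtain f where f: "f \<in> bounded_cocycles (Sp_infinity R) 2" "X = bounded_class (Sp_infinity R) 2 f"
    using X by (auto simp: carrier_bounded_cohomology)
  \<comment> \<open>One constant for all \<open>h\<close>: pulling \<open>f\<close> back cannot
    increase its supremum.\<close>
  obtain C where C: "\<forall>xs\<in>tuples (Sp_infinity R) 3. \<bar>f xs\<bar> \<le> C"
    using f(1) by (auto simp: bounded_cocycles_def bounded_cochains_def numeral_3_eq_3 numeral_2_eq_2)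
  have hom: "Sp_inclusion R h \<in> hom (Sp R h) (Sp_infinity R)" for h
    unfolding Sp_inclusion_def Sp_infinity_def by (rule Sp.colimit_inclusion_hom)
  define \<alpha> where "\<alpha> = arctan (1 / 2) + arctan (1 / 3)"
  have \<alpha>: "\<alpha> > 0" by (simp add: \<alpha>_def add_pos_pos)
  \<comment> \<open>Up to terms bounded in m, the defect of \<open>maslov\<close> is at most -2 m h
    \<alpha> and at least -12 m C; dividing by 2 m gives the constant 6.\<close>
  have "real h * \<alpha> \<le> 6 * C" for h
  proof -
    interpret G: group "Sp R h" by (rule group_Sp)
    define p where "p = cochain_pullback (Sp R h) (Sp_inclusion R h) 2 f"
    have "bounded_class (Sp R h) 2 (maslov R h) = bounded_class (Sp R h) 2 p"
      using fun_cong[OF res, of h] unfolding Sp_restriction_def f(2) p_def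
      by (simp add: bounded_cohomology_map_class[OF group_Sp hom])
    then have "(\<lambda>xs. maslov R h xs - p xs) \<in> coboundary (Sp R h) 1 ` bounded_cochains (Sp R h) 1"
      by (simp add: bounded_class_eq_iff bounded_coboundaries_def numeral_2_eq_2)
    then obtain b where b: "b \<in> bounded_cochains (Sp R h) 1"
      and mb: "(\<lambda>xs. maslov R h xs - p xs) = coboundary (Sp R h) 1 b" by auto
    have split: "maslov R h = (\<lambda>xs. p xs + coboundary (Sp R h) 1 b xs)"
      unfolding mb[symmetric] by simp
    have p: "\<bar>p xs\<bar> \<le> C" if "xs \<in> tuples (Sp R h) 3" for xs
      using C tuples_map[OF hom that] that by (simp add: p_def cochain_pullback_def)
    define s u where "s = diag_sl h 0 (-1) 1 (0 :: 'a)" and "u = diag_sl h 0 1 (-1) (-1 :: 'a)"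
    note su = homogeneous_defect_maslov(1,2)[of h R, folded s_def u_def]
    obtain B where B: "\<And>N. \<bar>homogeneous_defect (Sp R h) (coboundary (Sp R h) 1 b) s u N\<bar> \<le> B"
      using G.homogeneous_defect_coboundary[OF b su] by blast
    \<comment> \<open>\<open>B\<close> may depend on \<open>h\<close> but not on \<open>m\<close>,
      so for fixed \<open>h\<close> large \<open>m\<close> forces the factor after
      \<open>real m\<close> to be nonpositive.\<close>
    have le: "real m * (2 * (real h * \<alpha> - 6 * C)) \<le> real h * (pi / 2) + B" for m
    proof -
      have "- (4 * (real (3 * m) * C)) - B \<le> homogeneous_defect (Sp R h) (maslov R h) s u (3 * m)"
        unfolding split homogeneous_defect_add
        using G.homogeneous_defect_bound[where q = p and N = "3 * m", OF p su] B[of "3 * m"] by linarith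
      also have "\<dots> \<le> real h * (pi / 2 - 2 * real m * \<alpha>)"
        unfolding s_def u_def \<alpha>_def by (rule homogeneous_defect_maslov(3))
      finally show ?thesis by (simp add: algebra_simps)
    qed
    show ?thesis
    proof (rule ccontr)
      assume "\<not> ?thesis"
      then have "6 * C < real h * \<alpha>" by (rule not_le_imp_less)
      then have "0 < 2 * (real h * \<alpha> - 6 * C)" by argo
      then obtain m :: nat where "real h * (pi / 2) + B < real m * (2 * (real h * \<alpha> - 6 * C))"
        using reals_Archimedean3 by blast
      then show False using le[of m] by simp
    qed
  qed
  moreover obtain h :: nat where "6 * C < real h * \<alpha>"
    using reals_Archimedean3[OF \<alpha>] by blast
  ultimately show False by (metis not_le)
qed

end

theorem mainTheorem9:
  shows
    "\<not> (\<forall>n. carrier (Sp_stable_bounded_cohomology TYPE(int) n)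
          \<subseteq> Sp_restriction TYPE(int) n ` carrier (bounded_cohomology (Sp_infinity TYPE(int)) n)) \<and>
     \<not> (\<forall>n. carrier (Sp_stable_bounded_cohomology TYPE(real) n)
          \<subseteq> Sp_restriction TYPE(real) n ` carrier (bounded_cohomology (Sp_infinity TYPE(real)) n))"
proof -
  interpret Z: real_embedding "of_int :: int \<Rightarrow> complex" by unfold_locales auto
  interpret R: real_embedding "of_real :: real \<Rightarrow> complex" by unfold_locales auto
  \<comment> \<open>Degree 2 refutes the quantifier over \<open>n\<close> for each of the two
    rings.\<close>
  show ?thesis
    using Z.stable_restriction_not_surjective R.stable_restriction_not_surjective by blast
qed

end
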